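(* For every $\alpha\in(0,1]$ the set difference $$\mathcal{A}(\alpha)\setminus\bigcup_{0\le\beta<\alpha}\mathcal{A}(\beta)$$ is nonempty.
   Context: $\mathbb{T}=\mathbb{R}/2\pi\mathbb{Z}$ is the circle group, identified with $[0,2\pi)$, with Lebesgue measure $|\cdot|$. All sets $\mathcal{S}\subset\mathbb{T}$ considered are measurable with $|\mathcal{S}|>0$, and all frequency sets are subsets $\Lambda\subset\mathbb{Z}$. For $\Lambda\subset\mathbb{Z}$ let $E(\Lambda)=\{e^{i\lambda t}\}_{\lambda\in\Lambda}$. $E(\Lambda)$ is a Riesz sequence in $L^2(\mathcal{S})$ if there exist constants $A,B>0$ such that $$A\sum_{\lambda\in\Lambda}|a_\lambda|^2\le\Big\|\sum_{\lambda\in\Lambda}a_\lambda e^{i\lambda t}\Big\|_{L^2(\mathcal{S})}^2\le B\sum_{\lambda\in\Lambda}|a_\lambda|^2$$ for every finite sequence of (complex) coefficients $\{a_\lambda\}$. For $\alpha\in[0,1]$, a set $\mathcal{S}$ belongs to the class $\mathcal{A}(\alpha)$ if there is $\Lambda\subset\mathbb{Z}$ such that $E(\Lambda)$ is a Riesz sequence in $L^2(\mathcal{S})$ and $\Lambda$ contains, for infinitely many $N\in\mathbb{N}$, an arithmetic progression of length $N$ and step $\ell=O(N^\alpha)$; that is, there are a constant $C>0$ and infinitely many $N\in\mathbb{N}$ for each of which there exist $M\in\mathbb{Z}$ and $\ell\in\mathbb{N}$, $\ell\ge1$, with $\ell\le CN^\alpha$ and $M+\{\ell,2\ell,\ldots,N\ell\}\subset\Lambda$.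 *)

theory Defs
  imports "HOL-Analysis.Analysis"
begin

(* The circle group R / 2 pi Z is identified with the interval [0, 2 pi). *)
definition circle :: "real set" where
  "circle = {0..<2 * pi}"

definition L2_norm_on :: "real set \<Rightarrow> (real \<Rightarrow> complex) \<Rightarrow> real" where
  "L2_norm_on S f = sqrt (LINT t:S|lebesgue. (cmod (f t))\<^sup>2)"

(* E(Lam) is a Riesz sequence in L2(S).  A finite sequence of coefficients is given by a finite
   F \<subseteq> Lam together with the values of a on F; cis (l * t) is e^(i l t). *)
definition riesz_sequence :: "int set \<Rightarrow> real set \<Rightarrow> bool" where
  "riesz_sequence Lam S \<longleftrightarrow>
     (\<exists>A B. A > 0 \<and> B > 0 \<and>
       (\<forall>(F :: int set) (a :: int \<Rightarrow> complex). finite F \<and> F \<subseteq> Lam \<longrightarrow>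
          A * (\<Sum>l\<in>F. (cmod (a l))\<^sup>2) \<le> (L2_norm_on S (\<lambda>t. \<Sum>l\<in>F. a l * cis (of_int l * t)))\<^sup>2 \<and>
          (L2_norm_on S (\<lambda>t. \<Sum>l\<in>F. a l * cis (of_int l * t)))\<^sup>2 \<le> B * (\<Sum>l\<in>F. (cmod (a l))\<^sup>2)))"

definition long_progressions :: "real \<Rightarrow> int set \<Rightarrow> bool" where
  "long_progressions \<alpha> Lam \<longleftrightarrow>
     (\<exists>C>0. infinite {N :: nat. \<exists>(M :: int) (l :: nat). l \<ge> 1 \<and> real l \<le> C * real N powr \<alpha> \<and>
        (\<lambda>k :: nat. M + int (k * l)) ` {1..N} \<subseteq> Lam})"

definition class_A :: "real \<Rightarrow> real set set" where
  "class_A \<alpha> =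
     {S. S \<subseteq> circle \<and> S \<in> sets lebesgue \<and> measure lebesgue S > 0 \<and>
         (\<exists>Lam :: int set. riesz_sequence Lam S \<and> long_progressions \<alpha> Lam)}"

end

theory Submission
  imports Defs
    "HOL-Computational_Algebra.Primes"
    "HOL-Number_Theory.Cong"
    "HOL-Real_Asymp.Real_Asymp"
begin

text \<open>
  Let \<open>D n u = (\<Sum>k<n. cis (k * u))\<close> be the Dirichlet kernel and let \<open>w m\<close> be \<open>K m\<^sup>p (1 + ln m)\<^sup>2\<close>, rounded
  up, with \<open>p = 1 / \<alpha>\<close> and \<open>K\<close> large. The set consists of the points \<open>t\<close> of the circle with
  \<open>\<bar>D (w m) (m t)\<bar> \<le> w m / 2\<close> for all \<open>m \<ge> 1\<close>; so a neighbourhood of radius about \<open>1 / w m\<close> of \<open>0\<close> is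
  removed from the range of \<open>m t\<close>.

  On this set every kernel \<open>D N (l t)\<close> is \<open>O(w l)\<close>. Hence the square of \<open>D N (l t)\<close> has \<open>L\<^sup>2\<close> norm
  \<open>O(w l * sqrt N)\<close>, while its coefficients have norm of order \<open>N powr (3 / 2)\<close>. A Riesz sequence containing a
  progression of step \<open>l\<close> and length \<open>2 N\<close> therefore forces \<open>N = O(w l)\<close>, which fails for \<open>l = O(N powr \<beta>)\<close>
  with \<open>\<beta> < \<alpha>\<close>.

  Conversely, let \<open>l\<close> be prime, \<open>N\<close> the integer part of \<open>l powr p\<close>, and \<open>f\<close> a sum with frequencies
  \<open>l, 2 l, \<dots>, N l\<close>. Then \<open>\<bar>f\<bar>\<^sup>2\<close> integrated over the complement is at most the sum over \<open>m\<close> of the integrals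
  of \<open>4 \<bar>D (w m) (m t) f t\<bar>\<^sup>2 / (w m)\<^sup>2\<close>, and by Parseval and Cauchy-Schwarz each of these is controlled by the
  maximal number of solutions of \<open>m k + l j = h\<close>. The total is a small fraction of the norm of \<open>f\<close>. Finally,
  the Fourier coefficients of the indicator of the set tend to zero, so translates of infinitely many such
  progressions that are far enough apart together still form a Riesz sequence.
\<close>

section \<open>Trigonometric sums on the circle\<close>

definition trig_sum :: "int set \<Rightarrow> (int \<Rightarrow> complex) \<Rightarrow> real \<Rightarrow> complex" where
  "trig_sum F a t = (\<Sum>l\<in>F. a l * cis (of_int l * t))"

lemma continuous_on_trig_sum [continuous_intros]: "continuous_on A (trig_sum F a)"
  unfolding trig_sum_def by (intro continuous_intros)

lemma circle_sets [simp]: "circle \<in> sets lebesgue"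
  by (simp add: circle_def)

lemma set_integrable_circle:
  fixes g :: "real \<Rightarrow> 'b::euclidean_space"
  assumes "continuous_on UNIV g" "S \<in> sets lebesgue" "S \<subseteq> circle"
  shows "set_integrable lebesgue S g"
proof -
  have "set_integrable lebesgue {0..2*pi} g"
    using assms(1) continuous_on_subset by (blast intro: absolutely_integrable_continuous_real)
  then show ?thesis
    by (rule set_integrable_subset) (use assms(2,3) in \<open>auto simp: circle_def\<close>)
qed

lemma set_integral_sum:
  fixes f :: "'i \<Rightarrow> 'a \<Rightarrow> 'b::{banach, second_countable_topology}"
  assumes "\<And>i. i \<in> I \<Longrightarrow> set_integrable M A (f i)"
  shows "set_integrable M A (\<lambda>x. \<Sum>i\<in>I. f i x)"
    and "(LINT x:A|M. \<Sum>i\<in>I. f i x) = (\<Sum>i\<in>I. LINT x:A|M. f i x)"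
  using assms unfolding set_integrable_def set_lebesgue_integral_def
  by (simp_all add: scaleR_sum_right integral_sum)

lemma integral_circle_cis:
  "(LINT t:circle|lebesgue. cis (of_int n * t)) = (if n = 0 then 2 * pi else 0)"
proof -
  have "(LINT t:circle|lebesgue. cis (of_int n * t)) = integral circle (\<lambda>t. cis (of_int n * t))"
    by (intro set_lebesgue_integral_eq_integral(2) set_integrable_circle continuous_intros) auto
  also have "\<dots> = integral {0..2*pi} (\<lambda>t. cis (of_int n * t))"
  proof (rule integral_spike_set)
    show "negligible {t \<in> circle - {0..2*pi}. cis (of_int n * t) \<noteq> 0}"
      by (rule negligible_subset[of "{}"]) (auto simp: circle_def)
    show "negligible {t \<in> {0..2*pi} - circle. cis (of_int n * t) \<noteq> 0}"
      by (rule negligible_subset[of "{2*pi}"]) (auto simp: circle_def)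
  qed
  also have "\<dots> = (if n = 0 then 2 * pi else 0)"
  proof (cases "n = 0")
    case False
    define G where "G t = cis (of_int n * t) / (\<i> * of_int n)" for t :: real
    have "(G has_vector_derivative cis (of_int n * t)) (at t within {0..2*pi})" for t
    proof -
      have "((\<lambda>z. exp (\<i> * (of_int n * z)) / (\<i> * of_int n))
          has_field_derivative exp (\<i> * (of_int n * of_real t))) (at (of_real t))"
        using False by (auto intro!: derivative_eq_intros simp: mult_ac)
      then show ?thesis
        unfolding G_def cis_conv_exp of_real_mult of_real_of_int_eq
        by (rule has_vector_derivative_real_field)
    qed
    then have "((\<lambda>t. cis (of_int n * t)) has_integral G (2 * pi) - G 0) {0..2*pi}"
      by (intro fundamental_theorem_of_calculus) auto
    moreover have "cis (of_int n * (2 * pi)) = 1"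
      by (metis cis_multiple_2pi mult.commute mult.left_commute Ints_of_int)
    ultimately show ?thesis using False by (simp add: G_def integral_unique)
  qed (simp add: scaleR_conv_of_real)
  finally show ?thesis .
qed

text \<open>Up to conjugation and normalization, a Fourier coefficient of the indicator function of
  \<open>S\<close>. The values at \<open>l - k\<close> form the Gram matrix of the exponentials in
  L2(S).\<close>

definition fourier_ind :: "real set \<Rightarrow> int \<Rightarrow> complex" where
  "fourier_ind S n = (LINT t:S|lebesgue. cis (of_int n * t))"

lemma integral_trig_sum_mult_cnj:
  assumes "finite F" "finite G" "S \<in> sets lebesgue" "S \<subseteq> circle"
  shows "(LINT t:S|lebesgue. trig_sum F a t * cnj (trig_sum G b t)) =
    (\<Sum>l\<in>F. \<Sum>k\<in>G. a l * cnj (b k) * fourier_ind S (l - k))"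
proof -
  have eq: "trig_sum F a t * cnj (trig_sum G b t) =
      (\<Sum>l\<in>F. \<Sum>k\<in>G. a l * cnj (b k) * cis (of_int (l - k) * t))" for t
    by (simp add: trig_sum_def cnj_sum sum_product cis_cnj cis_mult[symmetric] mult_ac
        ring_distribs diff_conv_add_uminus del: add_uminus_conv_diff)
  have int: "set_integrable lebesgue S (\<lambda>t. a l * cnj (b k) * cis (of_int (l - k) * t))" for l k
    by (intro set_integrable_circle continuous_intros assms)
  have "(LINT t:S|lebesgue. trig_sum F a t * cnj (trig_sum G b t)) =
      (\<Sum>l\<in>F. \<Sum>k\<in>G. LINT t:S|lebesgue. a l * cnj (b k) * cis (of_int (l - k) * t))"
    unfolding eq using assms(1,2)
    by (simp only: set_integral_sum int)
  also have "\<dots> = (\<Sum>l\<in>F. \<Sum>k\<in>G. a l * cnj (b k) * fourier_ind S (l - k))"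
    unfolding fourier_ind_def by simp
  finally show ?thesis .
qed

lemma parseval_trig_sum:
  assumes "finite F"
  shows "(LINT t:circle|lebesgue. (cmod (trig_sum F a t))\<^sup>2) = 2 * pi * (\<Sum>l\<in>F. (cmod (a l))\<^sup>2)"
proof -
  have "of_real (LINT t:circle|lebesgue. (cmod (trig_sum F a t))\<^sup>2) =
      (LINT t:circle|lebesgue. trig_sum F a t * cnj (trig_sum F a t))"
    by (simp add: complex_norm_square[symmetric] set_integral_complex_of_real flip: of_real_power)
  also have "\<dots> = (\<Sum>l\<in>F. \<Sum>k\<in>F. a l * cnj (a k) * (if l = k then 2 * pi else 0))"
    using assms integral_circle_cis
    by (simp only: integral_trig_sum_mult_cnj fourier_ind_def circle_sets subset_refl
        right_minus_eq)
  also have "\<dots> = (\<Sum>l\<in>F. a l * cnj (a l) * (2 * pi))"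
    using assms by (simp add: if_distrib cong: if_cong)
  also have "\<dots> = of_real (2 * pi * (\<Sum>l\<in>F. (cmod (a l))\<^sup>2))"
    by (simp add: complex_norm_square[symmetric] sum_distrib_left mult_ac del: of_real_power)
  finally show ?thesis using of_real_eq_iff by blast
qed

section \<open>Lower Riesz bounds and gluing of blocks\<close>

text \<open>Only the lower inequality is tracked, because Parseval on the circle gives the upper one
  with constant 2 pi for every measurable subset.\<close>

definition riesz_lower :: "real set \<Rightarrow> real \<Rightarrow> int set \<Rightarrow> bool" where
  "riesz_lower S A F \<longleftrightarrow>
     (\<forall>a. A * (\<Sum>l\<in>F. (cmod (a l))\<^sup>2) \<le> (LINT t:S|lebesgue. (cmod (trig_sum F a t))\<^sup>2))"

lemma integrable_cmod_trig_sum: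
  assumes "S \<in> sets lebesgue" "S \<subseteq> circle"
  shows "set_integrable lebesgue S (\<lambda>t. (cmod (trig_sum F a t))\<^sup>2)"
  by (intro set_integrable_circle continuous_intros assms)

lemma integral_cmod_trig_sum_nonneg:
  "0 \<le> (LINT t:S|lebesgue. (cmod (trig_sum F a t))\<^sup>2)"
  unfolding set_lebesgue_integral_def by (intro integral_nonneg_AE) auto

lemma L2_norm_on_trig_sum:
  "(L2_norm_on S (\<lambda>t. \<Sum>l\<in>F. a l * cis (of_int l * t)))\<^sup>2 =
     (LINT t:S|lebesgue. (cmod (trig_sum F a t))\<^sup>2)"
  unfolding L2_norm_on_def trig_sum_def[symmetric]
  by (simp add: integral_cmod_trig_sum_nonneg)

lemma integral_trig_sum_le_circle:
  assumes "finite F" "S \<in> sets lebesgue" "S \<subseteq> circle"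
  shows "(LINT t:S|lebesgue. (cmod (trig_sum F a t))\<^sup>2) \<le> 2 * pi * (\<Sum>l\<in>F. (cmod (a l))\<^sup>2)"
proof -
  have "(LINT t:S|lebesgue. (cmod (trig_sum F a t))\<^sup>2) \<le>
      (LINT t:circle|lebesgue. (cmod (trig_sum F a t))\<^sup>2)"
    unfolding set_lebesgue_integral_def
    by (rule integral_mono)
       (use assms integrable_cmod_trig_sum[of S] integrable_cmod_trig_sum[of circle]
         in \<open>auto simp: set_integrable_def indicator_def\<close>)
  then show ?thesis by (simp add: parseval_trig_sum assms)
qed

lemma riesz_lower_antimono:
  assumes "riesz_lower S A G" "F \<subseteq> G" "finite G"
  shows "riesz_lower S A F"
  unfolding riesz_lower_def
proof
  fix a :: "int \<Rightarrow> complex"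
  define b where "b l = (if l \<in> F then a l else 0)" for l
  have "(\<Sum>l\<in>G. (cmod (b l))\<^sup>2) = (\<Sum>l\<in>F. (cmod (a l))\<^sup>2)"
    by (rule sum.mono_neutral_cong_right) (use assms in \<open>auto simp: b_def\<close>)
  moreover have "trig_sum G b = trig_sum F a"
    unfolding trig_sum_def
    by (intro ext sum.mono_neutral_cong_right) (use assms in \<open>auto simp: b_def\<close>)
  ultimately show "A * (\<Sum>l\<in>F. (cmod (a l))\<^sup>2) \<le> (LINT t:S|lebesgue. (cmod (trig_sum F a t))\<^sup>2)"
    using assms(1) unfolding riesz_lower_def by metis
qed

lemma riesz_lower_mono:
  assumes "riesz_lower S A F" "A' \<le> A"
  shows "riesz_lower S A' F"
  using assms unfolding riesz_lower_def
  by (meson mult_right_mono order_trans sum_nonneg zero_le_power2)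

text \<open>A shift of all frequencies by \<open>M\<close> multiplies the sum by a unimodular
  factor, so its modulus does not change on any set.\<close>

lemma riesz_lower_translate:
  assumes "riesz_lower S A F"
  shows "riesz_lower S A ((+) M ` F)"
  unfolding riesz_lower_def
proof
  fix a :: "int \<Rightarrow> complex"
  define b where "b l = a (M + l)" for l
  have "trig_sum ((+) M ` F) a t = cis (of_int M * t) * trig_sum F b t" for t
    unfolding trig_sum_def
    by (subst sum.reindex)
       (simp_all add: sum_distrib_left b_def cis_mult ring_distribs mult_ac add_ac)
  then have "cmod (trig_sum ((+) M ` F) a t) = cmod (trig_sum F b t)" for t
    by (simp add: norm_mult)
  moreover have "(\<Sum>l\<in>(+) M ` F. (cmod (a l))\<^sup>2) = (\<Sum>l\<in>F. (cmod (b l))\<^sup>2)"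
    by (subst sum.reindex) (simp_all add: b_def)
  ultimately show "A * (\<Sum>l\<in>(+) M ` F. (cmod (a l))\<^sup>2) \<le>
      (LINT t:S|lebesgue. (cmod (trig_sum ((+) M ` F) a t))\<^sup>2)"
    using assms unfolding riesz_lower_def by simp
qed

section \<open>Decay of the Fourier coefficients of an indicator function\<close>

lemma bessel_fourier_ind:
  assumes "finite F" "S \<in> sets lebesgue" "S \<subseteq> circle"
  shows "(\<Sum>n\<in>F. (cmod (fourier_ind S n))\<^sup>2) \<le> 8 * pi * measure lebesgue S"
proof -
  define h where "h = trig_sum F (\<lambda>n. cnj (fourier_ind S n))"
  define Q where "Q = (\<Sum>n\<in>F. (cmod (fourier_ind S n))\<^sup>2)"
  have cont: "continuous_on UNIV h" unfolding h_def by (rule continuous_on_trig_sum)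
  have S_fin: "emeasure lebesgue S < \<infinity>"
  proof -
    have "emeasure lebesgue S \<le> emeasure lebesgue {0..2*pi}"
      by (rule emeasure_mono) (use assms(3) in \<open>auto simp: circle_def\<close>)
    also have "\<dots> < \<infinity>" by simp
    finally show ?thesis .
  qed
  have "(LINT t:S|lebesgue. h t) = (\<Sum>n\<in>F. cnj (fourier_ind S n) * fourier_ind S n)"
    unfolding h_def trig_sum_def fourier_ind_def
    by (subst set_integral_sum(2)) (intro set_integrable_circle continuous_intros assms, simp)
  also have "\<dots> = of_real Q"
    unfolding Q_def of_real_sum complex_norm_square by (simp add: mult.commute)
  finally have hQ: "(LINT t:S|lebesgue. h t) = of_real Q" .
  have ReQ: "(LINT t:S|lebesgue. Re (h t)) = Q"
  proof -
    have "Re (LINT t:S|lebesgue. h t) = (LINT t:S|lebesgue. Re (h t))"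
      using integral_Re[of lebesgue "\<lambda>t. indicator S t *\<^sub>R h t"]
        set_integrable_circle[OF cont assms(2,3)]
      by (simp add: set_integrable_def set_lebesgue_integral_def)
    then show ?thesis using hQ by simp
  qed
  have int2: "(LINT t:S|lebesgue. (cmod (h t))\<^sup>2) \<le> 2 * pi * Q"
    using integral_trig_sum_le_circle[OF assms, of "\<lambda>n. cnj (fourier_ind S n)"]
    by (simp add: h_def Q_def)
  \<comment> \<open>The sum \<open>h\<close> is the projection of the indicator up to scaling: its
    integral over \<open>S\<close> is \<open>Q\<close>, and its squared norm there is at most 2 pi
    \<open>Q\<close>. Expanding the square around any constant above pi makes the total coefficient
    of \<open>Q\<close> negative; the choice 4 pi gives -6 pi.\<close>
  have "0 \<le> (LINT t:S|lebesgue. (cmod (h t - 4 * pi))\<^sup>2)"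
    unfolding set_lebesgue_integral_def by (intro integral_nonneg_AE) auto
  also have "\<dots> = (LINT t:S|lebesgue. (cmod (h t))\<^sup>2 - 8 * pi * Re (h t) + 16 * pi\<^sup>2)"
    unfolding cmod_power2
    by (rule arg_cong[where f = "set_lebesgue_integral lebesgue S"])
       (auto simp: power2_eq_square algebra_simps)
  also have "\<dots> = (LINT t:S|lebesgue. (cmod (h t))\<^sup>2) - 8 * pi * Q + 16 * pi\<^sup>2 * measure lebesgue S"
  proof -
    have "set_integrable lebesgue S (\<lambda>t. (cmod (h t))\<^sup>2)"
      and "set_integrable lebesgue S (\<lambda>t. 8 * pi * Re (h t))"
      and "set_integrable lebesgue S (\<lambda>t. 16 * pi\<^sup>2)"
      by (intro set_integrable_circle continuous_intros cont assms)+
    then show ?thesis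
      using S_fin by (simp add: set_integral_add set_integral_diff ReQ set_integral_const assms(2))
  qed
  also have "\<dots> \<le> - 6 * pi * Q + 16 * pi\<^sup>2 * measure lebesgue S"
    using int2 by (simp add: mult_ac)
  finally have "pi * (6 * Q) \<le> pi * (16 * pi * measure lebesgue S)"
    by (simp add: power2_eq_square mult_ac)
  then have "6 * Q \<le> 16 * pi * measure lebesgue S"
    using mult_le_cancel_left_pos[OF pi_gt_zero] by blast
  moreover have "0 \<le> pi * measure lebesgue S" by simp
  ultimately show ?thesis unfolding Q_def by linarith
qed

text \<open>Each such \<open>n\<close> contributes at least \<open>\<epsilon>\<^sup>2\<close> to the
  sum in Bessel's inequality, whose bound does not depend on the set of frequencies.\<close>

lemma finite_large_fourier_ind:
  assumes "S \<in> sets lebesgue" "S \<subseteq> circle" "\<epsilon> > 0"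
  shows "finite {n. \<epsilon> \<le> cmod (fourier_ind S n)}"
proof (rule ccontr)
  assume inf: "infinite {n. \<epsilon> \<le> cmod (fourier_ind S n)}"
  obtain k :: nat where k: "8 * pi * measure lebesgue S < of_nat k * \<epsilon>\<^sup>2"
    using reals_Archimedean3[of "\<epsilon>\<^sup>2"] assms(3) by auto
  obtain F where F: "F \<subseteq> {n. \<epsilon> \<le> cmod (fourier_ind S n)}" "finite F" "card F = k"
    using infinite_arbitrarily_large[OF inf] by blast
  have "of_nat k * \<epsilon>\<^sup>2 = (\<Sum>n\<in>F. \<epsilon>\<^sup>2)" using F by simp
  also have "\<dots> \<le> (\<Sum>n\<in>F. (cmod (fourier_ind S n))\<^sup>2)"
    using F assms(3) by (intro sum_mono power_mono) auto
  also have "\<dots> \<le> 8 * pi * measure lebesgue S"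
    using bessel_fourier_ind F assms by blast
  finally show False using k by simp
qed

text \<open>For a suitable shift the two blocks are almost orthogonal in L2(S): the cross terms only
  involve \<open>fourier_ind\<close> at differences between the blocks, where it is small.\<close>

lemma riesz_lower_union_translate:
  assumes S: "S \<in> sets lebesgue" "S \<subseteq> circle"
    and F: "finite F" "riesz_lower S A F" and B: "finite B" "riesz_lower S A B" and "\<eta> > 0"
  shows "\<exists>M. riesz_lower S (A - \<eta>) (F \<union> (+) M ` B)"
proof -
  \<comment> \<open>Chosen so that the cross terms, summed over all pairs from both blocks, cost at
    most \<open>\<eta>\<close> times the squared coefficient norm.\<close>
  define \<epsilon> where "\<epsilon> = \<eta> / (card F + card B + 1)"
  have "\<epsilon> > 0" using assms by (simp add: \<epsilon>_def)
  define X where "X = {n. \<epsilon> \<le> cmod (fourier_ind S n)}"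
  \<comment> \<open>The finitely many bad shifts: those for which some cross difference hits a large
    coefficient, and those for which the blocks overlap.\<close>
  have "finite ((\<lambda>(n, l, k). l - k - n) ` (X \<times> F \<times> B) \<union> (\<lambda>(l, k). l - k) ` (F \<times> B))"
    using assms finite_large_fourier_ind[OF S \<open>\<epsilon> > 0\<close>] by (simp add: X_def)
  then obtain M where M: "M \<notin> (\<lambda>(n, l, k). l - k - n) ` (X \<times> F \<times> B)" "M \<notin> (\<lambda>(l, k). l - k) ` (F \<times> B)"
    by (metis UnCI ex_new_if_finite infinite_UNIV_int)
  define G where "G = (+) M ` B"
  have G: "finite G" "card G = card B" "riesz_lower S A G"
    using B by (auto simp: G_def card_image riesz_lower_translate)
  have disj: "F \<inter> G = {}" using M(2) by (force simp: G_def)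
  have small: "cmod (fourier_ind S (l - k)) \<le> \<epsilon>" if lk: "l \<in> F" "k \<in> G" for l k
  proof (rule ccontr)
    assume "\<not> ?thesis"
    then have "l - k \<in> X" by (simp add: X_def)
    moreover obtain b where "b \<in> B" "k = M + b" using lk by (auto simp: G_def)
    ultimately have "M \<in> (\<lambda>(n, l, k). l - k - n) ` (X \<times> F \<times> B)"
      using lk by (intro image_eqI[of _ _ "(l - k, l, b)"]) auto
    then show False using M by blast
  qed
  have "riesz_lower S (A - \<eta>) (F \<union> G)"
    unfolding riesz_lower_def
  proof
    fix a :: "int \<Rightarrow> complex"
    let ?f = "trig_sum F a" and ?g = "trig_sum G a"
    define s where "s H = (\<Sum>l\<in>H. (cmod (a l))\<^sup>2)" for H
    have s0: "s H \<ge> 0" for H by (simp add: s_def sum_nonneg)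
    define c where "c = (LINT t:S|lebesgue. ?f t * cnj (?g t))"
    have "cmod c \<le> (\<Sum>l\<in>F. \<Sum>k\<in>G. cmod (a l) * cmod (a k) * \<epsilon>)"
      unfolding c_def integral_trig_sum_mult_cnj[OF F(1) G(1) S]
      by (intro sum_norm_le) (auto simp: norm_mult intro!: mult_left_mono small)
    also have "\<dots> \<le> (\<Sum>l\<in>F. \<Sum>k\<in>G. \<epsilon> / 2 * ((cmod (a l))\<^sup>2 + (cmod (a k))\<^sup>2))"
    proof (intro sum_mono)
      fix l k
      have "2 * (cmod (a l) * cmod (a k)) \<le> (cmod (a l))\<^sup>2 + (cmod (a k))\<^sup>2"
        using sum_squares_bound[of "cmod (a l)" "cmod (a k)"] by simp
      then show "cmod (a l) * cmod (a k) * \<epsilon> \<le> \<epsilon> / 2 * ((cmod (a l))\<^sup>2 + (cmod (a k))\<^sup>2)"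
        using mult_left_mono[of "2 * (cmod (a l) * cmod (a k))" _ "\<epsilon> / 2"] \<open>\<epsilon> > 0\<close>
        by (simp add: mult_ac)
    qed
    also have "\<dots> = \<epsilon> / 2 * (card G * s F + card F * s G)"
      by (simp only: s_def sum.distrib sum_constant sum_distrib_left[symmetric])
    finally have "2 * cmod c \<le> \<epsilon> * (card G * s F + card F * s G)" by simp
    also have "\<dots> \<le> \<epsilon> * ((card F + card B + 1) * (s F + s G))"
      using \<open>\<epsilon> > 0\<close> G(2) s0[of F] s0[of G]
      by (intro mult_left_mono) (auto simp: algebra_simps)
    also have "\<dots> = \<eta> * (s F + s G)"
      by (simp add: \<epsilon>_def)
    finally have c: "2 * cmod c \<le> \<eta> * (s F + s G)" .
    have sum: "trig_sum (F \<union> G) a t = ?f t + ?g t" for t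
      unfolding trig_sum_def using F G disj by (intro sum.union_disjoint)
    have int: "set_integrable lebesgue S (\<lambda>t. ?f t * cnj (?g t))"
      by (intro set_integrable_circle continuous_intros S)
    then have Re_c: "(LINT t:S|lebesgue. Re (?f t * cnj (?g t))) = Re c"
      using integral_Re[of lebesgue "\<lambda>t. indicator S t *\<^sub>R (?f t * cnj (?g t))"]
      by (simp add: set_integrable_def set_lebesgue_integral_def c_def)
    have "(LINT t:S|lebesgue. (cmod (trig_sum (F \<union> G) a t))\<^sup>2) =
        (LINT t:S|lebesgue. (cmod (?f t))\<^sup>2 + (cmod (?g t))\<^sup>2 + 2 * Re (?f t * cnj (?g t)))"
      unfolding sum cmod_power2
      by (rule arg_cong[where f = "set_lebesgue_integral lebesgue S"])
         (auto simp: power2_eq_square algebra_simps)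
    also have "\<dots> = (LINT t:S|lebesgue. (cmod (?f t))\<^sup>2) + (LINT t:S|lebesgue. (cmod (?g t))\<^sup>2) + 2 * Re c"
    proof -
      have "set_integrable lebesgue S (\<lambda>t. (cmod (?f t))\<^sup>2)"
        and "set_integrable lebesgue S (\<lambda>t. (cmod (?g t))\<^sup>2)"
        and "set_integrable lebesgue S (\<lambda>t. 2 * Re (?f t * cnj (?g t)))"
        by (intro set_integrable_circle continuous_intros S)+
      then show ?thesis
        by (simp only: set_integral_add set_integral_mult_right Re_c)
    qed
    also have "\<dots> \<ge> A * s F + A * s G - 2 * cmod c"
    proof -
      have "A * s F \<le> (LINT t:S|lebesgue. (cmod (?f t))\<^sup>2)" "A * s G \<le> (LINT t:S|lebesgue. (cmod (?g t))\<^sup>2)"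
        using F G unfolding riesz_lower_def s_def by auto
      moreover have "- cmod c \<le> Re c" using abs_Re_le_cmod[of c] by linarith
      ultimately show ?thesis by linarith
    qed
    finally have "A * s F + A * s G - 2 * cmod c \<le> (LINT t:S|lebesgue. (cmod (trig_sum (F \<union> G) a t))\<^sup>2)" .
    moreover have "(\<Sum>l\<in>F \<union> G. (cmod (a l))\<^sup>2) = s F + s G"
      unfolding s_def using F G disj by (intro sum.union_disjoint)
    ultimately show "(A - \<eta>) * (\<Sum>l\<in>F \<union> G. (cmod (a l))\<^sup>2) \<le>
        (LINT t:S|lebesgue. (cmod (trig_sum (F \<union> G) a t))\<^sup>2)"
      using c by (simp add: algebra_simps)
  qed
  then show ?thesis by (auto simp: G_def)
qed

lemma riesz_sequence_of_blocks:
  assumes S: "S \<in> sets lebesgue" "S \<subseteq> circle" and "A > 0"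
    and B: "\<And>j::nat. finite (B j)" "\<And>j. riesz_lower S A (B j)"
  shows "\<exists>Lam. riesz_sequence Lam S \<and> (\<forall>j. \<exists>M. (+) M ` B j \<subseteq> Lam)"
proof -
  \<comment> \<open>The constants start at \<open>A\<close> and decrease towards
    \<open>A / 2\<close>; stage \<open>j\<close> may lose \<open>A / 2 ^ Suc (Suc j)\<close>, and
    these losses sum to \<open>A / 2\<close>.\<close>
  define K where "K j = A / 2 + A / 2 ^ Suc j" for j :: nat
  define P where "P j F \<longleftrightarrow> finite F \<and> riesz_lower S (K j) F" for j F
  define Q where "Q j F F' \<longleftrightarrow> (\<exists>M. F' = F \<union> (+) M ` B j)" for j F F'
  have P0: "P 0 {}" by (simp add: P_def riesz_lower_def trig_sum_def set_lebesgue_integral_def)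
  have step: "\<exists>F'. P (Suc j) F' \<and> Q j F F'" if Pj: "P j F" for j F
  proof -
    have "K j \<le> A"
      using \<open>A > 0\<close> power_increasing[of 1 "Suc j" "2::real"]
      by (simp add: K_def field_simps)
    then have "riesz_lower S (K j) (B j)" using B riesz_lower_mono by blast
    moreover have "A / 2 ^ Suc (Suc j) > 0" using \<open>A > 0\<close> by simp
    ultimately obtain M where "riesz_lower S (K j - A / 2 ^ Suc (Suc j)) (F \<union> (+) M ` B j)"
      using riesz_lower_union_translate[OF S, of F "K j" "B j" "A / 2 ^ Suc (Suc j)"] Pj B(1)
      unfolding P_def by auto
    moreover have "K j - A / 2 ^ Suc (Suc j) = K (Suc j)" by (simp add: K_def)
    ultimately have "P (Suc j) (F \<union> (+) M ` B j)" using Pj B(1) by (simp add: P_def)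
    then show ?thesis unfolding Q_def by blast
  qed
  have "\<exists>F. \<forall>j. P j (F j) \<and> Q j (F j) (F (Suc j))"
    by (rule dependent_nat_choice) (use P0 step in blast)+
  then obtain F where F: "\<And>j. P j (F j)" "\<And>j. Q j (F j) (F (Suc j))" by blast
  have mono: "F i \<subseteq> F j" if "i \<le> j" for i j
    by (rule lift_Suc_mono_le[of F]) (use F(2) that in \<open>auto simp: Q_def\<close>)
  define Lam where "Lam = (\<Union>j. F j)"
  have "riesz_sequence Lam S"
    unfolding riesz_sequence_def L2_norm_on_trig_sum
  proof (intro exI conjI allI impI)
    show "A / 2 > 0" "2 * pi > 0" using \<open>A > 0\<close> by auto
    fix G :: "int set" and a :: "int \<Rightarrow> complex"
    assume G: "finite G \<and> G \<subseteq> Lam"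
    \<comment> \<open>A finite subset of an increasing union lies in a single stage, whose constant
      is above \<open>A / 2\<close>.\<close>
    have "\<exists>j. G \<subseteq> F j"
    proof -
      obtain f where f: "\<And>l. l \<in> G \<Longrightarrow> l \<in> F (f l)" using G unfolding Lam_def by (metis UN_E subsetD)
      have "l \<in> F (Max (f ` G))" if "l \<in> G" for l
        using mono[of "f l" "Max (f ` G)"] f that G by auto
      then show ?thesis by blast
    qed
    then obtain j where "G \<subseteq> F j" ..
    then have "riesz_lower S (K j) G" using F(1) riesz_lower_antimono unfolding P_def by blast
    then have "riesz_lower S (A / 2) G"
      by (rule riesz_lower_mono) (use \<open>A > 0\<close> in \<open>simp add: K_def\<close>)
    then show "A / 2 * (\<Sum>l\<in>G. (cmod (a l))\<^sup>2) \<le> (LINT t:S|lebesgue. (cmod (trig_sum G a t))\<^sup>2)"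
      unfolding riesz_lower_def by blast
    show "(LINT t:S|lebesgue. (cmod (trig_sum G a t))\<^sup>2) \<le> 2 * pi * (\<Sum>l\<in>G. (cmod (a l))\<^sup>2)"
      using integral_trig_sum_le_circle G S by blast
  qed
  moreover have "\<exists>M. (+) M ` B j \<subseteq> Lam" for j
    using F(2)[of j] unfolding Q_def Lam_def by blast
  ultimately show ?thesis by blast
qed

section \<open>Dirichlet kernels and thin sets\<close>

text \<open>As \<open>\<phi>\<close> need not be injective, terms of equal frequency are collected;
  this brings the sum into the form to which Parseval applies.\<close>

lemma sum_cis_eq_trig_sum:
  assumes "finite I"
  shows "(\<Sum>i\<in>I. a i * cis (of_int (\<phi> i) * t)) =
    trig_sum (\<phi> ` I) (\<lambda>f. \<Sum>i\<in>{i \<in> I. \<phi> i = f}. a i) t"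
proof -
  have "(\<Sum>i\<in>I. a i * cis (of_int (\<phi> i) * t)) =
      (\<Sum>f\<in>\<phi> ` I. \<Sum>i\<in>{i \<in> I. \<phi> i = f}. a i * cis (of_int (\<phi> i) * t))"
    by (rule sum.image_gen[OF assms])
  also have "\<dots> = trig_sum (\<phi> ` I) (\<lambda>f. \<Sum>i\<in>{i \<in> I. \<phi> i = f}. a i) t"
    unfolding trig_sum_def sum_distrib_right by (intro sum.cong) auto
  finally show ?thesis .
qed

definition dirichlet :: "nat \<Rightarrow> real \<Rightarrow> complex" where
  "dirichlet n u = (\<Sum>k<n. cis (real k * u))"

lemma continuous_on_dirichlet [continuous_intros]:
  "continuous_on A f \<Longrightarrow> continuous_on A (\<lambda>t. dirichlet n (f t))"
  unfolding dirichlet_def by (intro continuous_intros)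

lemma dirichlet_eq_powers: "dirichlet n u = (\<Sum>k<n. cis u ^ k)"
  unfolding dirichlet_def by (intro sum.cong) (simp_all add: Complex.DeMoivre)

text \<open>The geometric sum telescopes to \<open>1 - cis u ^ n\<close>, which gives a bound
  uniform in \<open>n\<close>.\<close>

lemma cmod_dirichlet_mult_le: "cmod (1 - cis u) * cmod (dirichlet n u) \<le> 2"
proof -
  have "cmod (1 - cis u) * cmod (dirichlet n u) = cmod (1 - cis u ^ n)"
    by (simp add: dirichlet_eq_powers one_diff_power_eq norm_mult)
  also have "\<dots> \<le> cmod 1 + cmod (cis u ^ n)" by (rule norm_triangle_ineq4)
  finally show ?thesis by (simp add: norm_power)
qed

lemma dirichlet_near_zero: "real n - cmod (dirichlet n u) \<le> (real n)\<^sup>2 * cmod (1 - cis u)"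
proof -
  have "of_nat n - dirichlet n u = (\<Sum>k<n. 1 ^ k - cis u ^ k)"
    by (simp add: dirichlet_eq_powers sum_subtractf)
  also have "cmod \<dots> \<le> (\<Sum>k<n. real n * cmod (1 - cis u))"
  proof (rule sum_norm_le)
    fix k assume "k \<in> {..<n}"
    have "cmod (1 ^ k - cis u ^ k) \<le> real k * cmod (1 - cis u)"
      by (rule norm_power_diff) auto
    also have "\<dots> \<le> real n * cmod (1 - cis u)"
      using \<open>k \<in> {..<n}\<close> by (intro mult_right_mono) auto
    finally show "cmod (1 ^ k - cis u ^ k) \<le> real n * cmod (1 - cis u)" .
  qed
  also have "\<dots> = (real n)\<^sup>2 * cmod (1 - cis u)" by (simp add: power2_eq_square)
  finally have "cmod (of_nat n - dirichlet n u) \<le> (real n)\<^sup>2 * cmod (1 - cis u)" .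
  moreover have "real n - cmod (dirichlet n u) \<le> cmod (of_nat n - dirichlet n u)"
    using norm_triangle_ineq2[of "of_nat n" "dirichlet n u"] by simp
  ultimately show ?thesis by linarith
qed

text \<open>If the kernel of one length \<open>n\<close> has dropped to half its peak, then
  \<open>cis u\<close> has distance at least 1 / (2 n) from 1 by \<open>dirichlet_near_zero\<close>.
  The geometric series then bounds the kernels of all lengths.\<close>

lemma dirichlet_transfer_bound:
  assumes "n \<ge> 1" "2 * cmod (dirichlet n u) \<le> real n"
  shows "cmod (dirichlet N u) \<le> 4 * real n"
proof -
  have "real n * 1 \<le> real n * (2 * real n * cmod (1 - cis u))"
    using dirichlet_near_zero[of n u] assms(2) unfolding power2_eq_square mult.assoc by linarith
  then have 1: "1 \<le> 2 * real n * cmod (1 - cis u)"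
    by (rule mult_left_le_imp_le) (use assms(1) in simp)
  have "cmod (dirichlet N u) \<le> (2 * real n * cmod (1 - cis u)) * cmod (dirichlet N u)"
    using mult_right_mono[OF 1, of "cmod (dirichlet N u)"] by simp
  also have "\<dots> \<le> 2 * real n * 2"
    using mult_left_mono[OF cmod_dirichlet_mult_le[of u N], of "2 * real n"] by (simp add: mult_ac)
  finally show ?thesis by simp
qed

text \<open>Closeness of \<open>m t\<close> to a multiple of 2 pi is expressed by the size of a
  Dirichlet kernel, not by a distance: a Chebyshev bound with its square then leads to products of
  trigonometric sums, which Parseval evaluates.\<close>

definition thin_set :: "(nat \<Rightarrow> nat) \<Rightarrow> real set" where
  "thin_set w = {t \<in> circle. \<forall>m\<ge>1. 2 * cmod (dirichlet (w m) (real m * t)) \<le> real (w m)}"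

lemma thin_set_subset: "thin_set w \<subseteq> circle"
  by (auto simp: thin_set_def)

lemma thin_set_measurable: "thin_set w \<in> sets lebesgue"
proof -
  have "{t. 2 * cmod (dirichlet (w m) (real m * t)) \<le> real (w m)} \<in> sets lebesgue" for m
  proof -
    have "closed {t. 2 * cmod (dirichlet (w m) (real m * t)) \<le> real (w m)}"
      by (intro closed_Collect_le continuous_intros)
    then show ?thesis by (simp add: borel_closed)
  qed
  then have "circle \<inter> (\<Inter>m\<in>{1..}. {t. 2 * cmod (dirichlet (w m) (real m * t)) \<le> real (w m)})
      \<in> sets lebesgue"
    by (intro sets.Int sets.countable_INT'') auto
  also have "circle \<inter> (\<Inter>m\<in>{1..}. {t. 2 * cmod (dirichlet (w m) (real m * t)) \<le> real (w m)})
      = thin_set w"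
    by (auto simp: thin_set_def)
  finally show ?thesis .
qed

text \<open>The test polynomial is the squared kernel: one factor is bounded pointwise on the set,
  the other by Parseval. The pointwise bound for the kernel alone would only yield N = O((w
  l)^2).\<close>

lemma riesz_lower_thin_set_bound:
  assumes A: "A > 0" "riesz_lower (thin_set w) A G" "finite G"
    and l: "l \<ge> 1" "w l \<ge> 1" and N: "N \<ge> 1"
    and G: "\<And>k. k \<in> {1..<2 * N} \<Longrightarrow> M + int (k * l) \<in> G"
  shows "A * (real N)\<^sup>2 \<le> 64 * pi * (real (w l))\<^sup>2"
proof -
  let ?S = "thin_set w"
  define I where "I = {..<N} \<times> {..<N}"
  \<comment> \<open>The \<open>+ 1\<close> moves the sums of two exponents from 0, ..., 2 N - 2 to
    the indices 1, ..., 2 N - 1 available in \<open>G\<close>.\<close>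
  define \<phi> where "\<phi> i = M + int ((fst i + snd i + 1) * l)" for i
  define b where "b f = (\<Sum>i\<in>{i \<in> I. \<phi> i = f}. 1 :: complex)" for f
  have finI: "finite I" by (simp add: I_def)
  have sub: "\<phi> ` I \<subseteq> (\<lambda>k. M + int (k * l)) ` {1..<2 * N}"
  proof (rule image_subsetI)
    fix i assume "i \<in> I"
    then show "\<phi> i \<in> (\<lambda>k. M + int (k * l)) ` {1..<2 * N}"
      by (intro image_eqI[of _ _ "fst i + snd i + 1"]) (auto simp: I_def \<phi>_def)
  qed
  have card: "real (card (\<phi> ` I)) \<le> 2 * real N"
  proof -
    have "card (\<phi> ` I) \<le> card {1..<2 * N}"
      using surj_card_le[OF _ sub] by simp
    then show ?thesis by simp
  qed
  have lower: "riesz_lower ?S A (\<phi> ` I)"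
    using A(2) by (rule riesz_lower_antimono) (use sub G A(3) in auto)
  have trig: "trig_sum (\<phi> ` I) b t = cis (of_int (M + int l) * t) * (dirichlet N (real l * t))\<^sup>2" for t
  proof -
    have "trig_sum (\<phi> ` I) b t = (\<Sum>i\<in>I. cis (of_int (\<phi> i) * t))"
      using sum_cis_eq_trig_sum[OF finI, of "\<lambda>_. 1" \<phi> t] by (simp add: b_def[abs_def])
    also have "\<dots> = (\<Sum>i\<in>I. cis (of_int (M + int l) * t) *
        (cis (real (fst i) * (real l * t)) * cis (real (snd i) * (real l * t))))"
      by (intro sum.cong) (auto simp: \<phi>_def cis_mult algebra_simps)
    also have "\<dots> = cis (of_int (M + int l) * t) * (dirichlet N (real l * t))\<^sup>2"
      unfolding sum_distrib_left[symmetric] unfolding dirichlet_def power2_eq_square sum_product I_def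
      by (simp only: sum.cartesian_product case_prod_unfold)
    finally show ?thesis .
  qed
  have sumb: "(\<Sum>f\<in>\<phi> ` I. b f) = of_nat (N\<^sup>2)"
  proof -
    have "(\<Sum>f\<in>\<phi> ` I. b f) = (\<Sum>i\<in>I. 1)"
      unfolding b_def by (rule sum.image_gen[OF finI, symmetric])
    then show ?thesis by (simp add: I_def card_cartesian_product power2_eq_square)
  qed
  \<comment> \<open>The coefficients sum to N^2 over at most 2 N frequencies, so by Cauchy-Schwarz
    their squares sum to at least N^3 / 2.\<close>
  have "(real N)\<^sup>2 \<le> (\<Sum>f\<in>\<phi> ` I. cmod (b f))"
    using norm_sum[of b "\<phi> ` I"] by (simp add: sumb norm_power)
  then have "((real N)\<^sup>2)\<^sup>2 \<le> (\<Sum>f\<in>\<phi> ` I. cmod (b f))\<^sup>2"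
    by (intro power_mono) auto
  also have "\<dots> \<le> (\<Sum>f\<in>\<phi> ` I. (cmod (b f))\<^sup>2) * real (card (\<phi> ` I))"
    by (rule sum_squared_le_sum_of_squares)
  also have "\<dots> \<le> (\<Sum>f\<in>\<phi> ` I. (cmod (b f))\<^sup>2) * (2 * real N)"
    by (intro mult_left_mono card sum_nonneg) auto
  finally have "A * ((real N)\<^sup>2)\<^sup>2 \<le> A * ((\<Sum>f\<in>\<phi> ` I. (cmod (b f))\<^sup>2) * (2 * real N))"
    using A(1) by (intro mult_left_mono) auto
  also have "\<dots> = (A * (\<Sum>f\<in>\<phi> ` I. (cmod (b f))\<^sup>2)) * (2 * real N)"
    by simp
  also have "\<dots> \<le> (LINT t:?S|lebesgue. (cmod (trig_sum (\<phi> ` I) b t))\<^sup>2) * (2 * real N)"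
    using lower unfolding riesz_lower_def by (intro mult_right_mono) auto
  also have "(LINT t:?S|lebesgue. (cmod (trig_sum (\<phi> ` I) b t))\<^sup>2) \<le>
      (LINT t:?S|lebesgue. (4 * real (w l))\<^sup>2 * (cmod (dirichlet N (real l * t)))\<^sup>2)"
  proof (rule set_integral_mono)
    fix t assume "t \<in> ?S"
    then have "cmod (dirichlet N (real l * t)) \<le> 4 * real (w l)"
      using l by (intro dirichlet_transfer_bound) (auto simp: thin_set_def)
    then have "(cmod (dirichlet N (real l * t)))\<^sup>2 * (cmod (dirichlet N (real l * t)))\<^sup>2
        \<le> (4 * real (w l))\<^sup>2 * (cmod (dirichlet N (real l * t)))\<^sup>2"
      by (intro mult_right_mono power_mono) auto
    then show "(cmod (trig_sum (\<phi> ` I) b t))\<^sup>2 \<le> (4 * real (w l))\<^sup>2 * (cmod (dirichlet N (real l * t)))\<^sup>2"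
      by (simp add: trig norm_mult norm_power power2_eq_square)
  qed (intro set_integrable_circle continuous_intros thin_set_measurable thin_set_subset)+
  also have "\<dots> = (4 * real (w l))\<^sup>2 * (LINT t:?S|lebesgue. (cmod (dirichlet N (real l * t)))\<^sup>2)"
    by (rule set_integral_mult_right)
  also have "(LINT t:?S|lebesgue. (cmod (dirichlet N (real l * t)))\<^sup>2) \<le> 2 * pi * real N"
  proof -
    define H where "H = (\<lambda>k. int (k * l)) ` {..<N}"
    have inj: "inj_on (\<lambda>k. int (k * l)) {..<N}" using l by (auto simp: inj_on_def)
    have "dirichlet N (real l * t) = trig_sum H (\<lambda>_. 1) t" for t
      unfolding dirichlet_def trig_sum_def H_def sum.reindex[OF inj] by (simp add: mult_ac)
    moreover have "finite H" "card H = N" unfolding H_def card_image[OF inj] by simp_all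
    ultimately show ?thesis
      using integral_trig_sum_le_circle[of H ?S "\<lambda>_. 1"] thin_set_measurable thin_set_subset
      by simp
  qed
  finally have "A * ((real N)\<^sup>2)\<^sup>2 \<le> (4 * real (w l))\<^sup>2 * (2 * pi * real N) * (2 * real N)"
    by (simp add: mult_left_mono mult_right_mono)
  then have "(A * (real N)\<^sup>2) * (real N)\<^sup>2 \<le> (64 * pi * (real (w l))\<^sup>2) * (real N)\<^sup>2"
    by (simp add: power2_eq_square mult_ac)
  then show ?thesis using N by simp
qed

section \<open>Representation counts\<close>

text \<open>After collecting equal frequencies and applying Parseval, Cauchy-Schwarz on each fibre
  of \<open>\<phi>\<close> costs the size of that fibre.\<close>

lemma integral_le_multiplicity:
  assumes "finite I" and R: "\<And>f. real (card {i \<in> I. \<phi> i = f}) \<le> R"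
  shows "(LINT t:circle|lebesgue. (cmod (\<Sum>i\<in>I. a i * cis (of_int (\<phi> i) * t)))\<^sup>2)
    \<le> 2 * pi * (R * (\<Sum>i\<in>I. (cmod (a i))\<^sup>2))"
proof -
  let ?J = "\<lambda>f. {i \<in> I. \<phi> i = f}"
  have "(LINT t:circle|lebesgue. (cmod (\<Sum>i\<in>I. a i * cis (of_int (\<phi> i) * t)))\<^sup>2) =
      2 * pi * (\<Sum>f\<in>\<phi> ` I. (cmod (\<Sum>i\<in>?J f. a i))\<^sup>2)"
    unfolding sum_cis_eq_trig_sum[OF assms(1)] by (simp add: parseval_trig_sum assms(1))
  also have "(\<Sum>f\<in>\<phi> ` I. (cmod (\<Sum>i\<in>?J f. a i))\<^sup>2) \<le> (\<Sum>f\<in>\<phi> ` I. \<Sum>i\<in>?J f. R * (cmod (a i))\<^sup>2)"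
  proof (rule sum_mono)
    fix f
    have "(cmod (\<Sum>i\<in>?J f. a i))\<^sup>2 \<le> (\<Sum>i\<in>?J f. cmod (a i))\<^sup>2"
      by (intro power_mono norm_sum) auto
    also have "\<dots> \<le> (\<Sum>i\<in>?J f. (cmod (a i))\<^sup>2) * real (card (?J f))"
      by (rule sum_squared_le_sum_of_squares)
    also have "\<dots> \<le> (\<Sum>i\<in>?J f. (cmod (a i))\<^sup>2) * R"
      by (intro mult_left_mono R sum_nonneg) auto
    finally show "(cmod (\<Sum>i\<in>?J f. a i))\<^sup>2 \<le> (\<Sum>i\<in>?J f. R * (cmod (a i))\<^sup>2)"
      by (simp add: sum_distrib_left sum_distrib_right mult.commute)
  qed
  also have "\<dots> = R * (\<Sum>i\<in>I. (cmod (a i))\<^sup>2)"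
    unfolding sum_distrib_left by (rule sum.image_gen[OF assms(1), symmetric])
  finally show ?thesis by simp
qed

text \<open>Here \<open>k\<close> runs over the exponents of a Dirichlet kernel, from 0, and
  \<open>j\<close> over the indices of a progression, from 1; the cardinality is the multiplicity of
  the frequency \<open>f\<close> in their product.\<close>

definition reps :: "nat \<Rightarrow> nat \<Rightarrow> nat \<Rightarrow> nat \<Rightarrow> nat \<Rightarrow> (nat \<times> nat) set" where
  "reps m l n N f = {(k, j) \<in> {..<n} \<times> {1..N}. m * k + l * j = f}"

lemma integral_dirichlet_mult_le:
  assumes R: "\<And>f. real (card (reps m l n N f)) \<le> R"
  shows "(LINT t:circle|lebesgue. (cmod (dirichlet n (real m * t)))\<^sup>2 *
      (cmod (\<Sum>j=1..N. a j * cis (of_int (int (j * l)) * t)))\<^sup>2)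
    \<le> 2 * pi * (R * (real n * (\<Sum>j=1..N. (cmod (a j))\<^sup>2)))"
proof -
  define I where "I = {..<n} \<times> {1..N}"
  define \<phi> where "\<phi> i = int (m * fst i + l * snd i)" for i
  have finI: "finite I" by (simp add: I_def)
  have 1: "real (card {i \<in> I. \<phi> i = f}) \<le> R" for f
  proof -
    \<comment> \<open>All frequencies are nonnegative, so for negative \<open>f\<close> the left
      side is empty and \<open>nat f\<close> does no harm.\<close>
    have "{i \<in> I. \<phi> i = f} \<subseteq> reps m l n N (nat f)" by (auto simp: I_def \<phi>_def reps_def simp del: of_nat_add of_nat_mult)
    moreover have "finite (reps m l n N (nat f))"
      by (rule finite_subset[of _ I]) (auto simp: I_def reps_def)
    ultimately show ?thesis using R[of "nat f"] by (meson card_mono of_nat_le_iff order_trans)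
  qed
  have "(cmod (dirichlet n (real m * t)))\<^sup>2 * (cmod (\<Sum>j=1..N. a j * cis (of_int (int (j * l)) * t)))\<^sup>2
      = (cmod (\<Sum>i\<in>I. a (snd i) * cis (of_int (\<phi> i) * t)))\<^sup>2" for t
  proof -
    have "dirichlet n (real m * t) * (\<Sum>j=1..N. a j * cis (of_int (int (j * l)) * t))
        = (\<Sum>i\<in>I. cis (real (fst i) * (real m * t)) * (a (snd i) * cis (of_int (int (snd i * l)) * t)))"
      unfolding dirichlet_def sum_product I_def
      by (simp only: sum.cartesian_product case_prod_unfold)
    also have "\<dots> = (\<Sum>i\<in>I. a (snd i) * cis (of_int (\<phi> i) * t))"
    proof (rule sum.cong)
      fix i
      have "cis (of_int (\<phi> i) * t) = cis (real (fst i) * (real m * t)) * cis (of_int (int (snd i * l)) * t)"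
        unfolding cis_mult by (rule arg_cong[where f = cis]) (simp add: \<phi>_def algebra_simps)
      then show "cis (real (fst i) * (real m * t)) * (a (snd i) * cis (of_int (int (snd i * l)) * t)) =
          a (snd i) * cis (of_int (\<phi> i) * t)"
        by (simp only: mult_ac)
    qed simp
    finally show ?thesis unfolding power_mult_distrib[symmetric] norm_mult[symmetric] by (rule arg_cong)
  qed
  moreover have "(\<Sum>i\<in>I. (cmod (a (snd i)))\<^sup>2) = real n * (\<Sum>j=1..N. (cmod (a j))\<^sup>2)"
    using sum.cartesian_product[of "\<lambda>k j. (cmod (a j))\<^sup>2" "{1..N}" "{..<n}"]
    by (simp add: I_def case_prod_unfold)
  ultimately show ?thesis
    using integral_le_multiplicity[OF finI 1, of "\<lambda>i. a (snd i)"] by simp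
qed

text \<open>Within one residue class an element is determined by its quotient, which has at most
  \<open>n div c + 1\<close> values.\<close>

lemma card_congruent_le:
  fixes c :: nat
  assumes "X \<subseteq> {..n}" "\<And>x y. x \<in> X \<Longrightarrow> y \<in> X \<Longrightarrow> [x = y] (mod c)"
  shows "card X \<le> n div c + 1"
proof -
  have "inj_on (\<lambda>x. x div c) X"
    using assms(2) by (intro inj_onI) (metis cong_def div_mult_mod_eq)
  moreover have "(\<lambda>x. x div c) ` X \<subseteq> {..n div c}" using assms(1) by (auto intro: div_le_mono)
  ultimately have "card X \<le> card {..n div c}" by (intro card_inj_on_le) auto
  then show ?thesis by simp
qed

text \<open>A solution is determined by \<open>k\<close>, and since \<open>m\<close> is invertible
  modulo \<open>l\<close>, the equation fixes \<open>k\<close> modulo \<open>l\<close>.\<close>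

lemma card_reps_le_left:
  assumes "coprime m l" "l \<ge> 1"
  shows "card (reps m l n N f) \<le> n div l + 1"
proof -
  have "inj_on fst (reps m l n N f)" using assms(2) by (auto simp: inj_on_def reps_def)
  then have "card (reps m l n N f) = card (fst ` reps m l n N f)" by (simp add: card_image)
  also have "\<dots> \<le> n div l + 1"
  proof (rule card_congruent_le)
    fix x y assume x: "x \<in> fst ` reps m l n N f" and y: "y \<in> fst ` reps m l n N f"
    obtain j j' where "(x, j) \<in> reps m l n N f" "(y, j') \<in> reps m l n N f"
      using x y by auto
    then have "m * x + l * j = m * y + l * j'" by (simp add: reps_def)
    then have "[m * x + l * j = m * y + l * j'] (mod l)" by simp
    then have "[m * x = m * y] (mod l)" by (simp add: cong_def)
    then show "[x = y] (mod l)" using assms(1) by (simp add: cong_mult_lcancel_nat)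
  qed (auto simp: reps_def)
  finally show ?thesis .
qed

lemma card_reps_le_right:
  assumes "coprime m l" "m \<ge> 1"
  shows "card (reps m l n N f) \<le> N div m + 1"
proof -
  have "inj_on snd (reps m l n N f)" using assms(2) by (auto simp: inj_on_def reps_def)
  then have "card (reps m l n N f) = card (snd ` reps m l n N f)" by (simp add: card_image)
  also have "\<dots> \<le> N div m + 1"
  proof (rule card_congruent_le)
    fix x y assume x: "x \<in> snd ` reps m l n N f" and y: "y \<in> snd ` reps m l n N f"
    obtain j j' where "(j, x) \<in> reps m l n N f" "(j', y) \<in> reps m l n N f"
      using x y by auto
    then have "m * j + l * x = m * j' + l * y" by (simp add: reps_def)
    then have "[m * j + l * x = m * j' + l * y] (mod m)" by simp
    then have "[l * x = l * y] (mod m)" by (simp add: cong_def)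
    then show "[x = y] (mod m)" using assms(1) by (simp add: cong_mult_lcancel_nat coprime_commute)
  qed (auto simp: reps_def)
  finally show ?thesis .
qed

lemma card_reps_le_length:
  assumes "m \<ge> 1"
  shows "card (reps m l n N f) \<le> N"
proof -
  have "inj_on snd (reps m l n N f)" using assms by (auto simp: inj_on_def reps_def)
  moreover have "snd ` reps m l n N f \<subseteq> {1..N}" by (auto simp: reps_def)
  ultimately have "card (reps m l n N f) \<le> card {1..N}" by (intro card_inj_on_le) auto
  then show ?thesis by simp
qed

text \<open>A union bound: off the thin set some \<open>m\<close> violates the defining condition,
  and there \<open>\<bar>f\<bar>\<^sup>2\<close> is dominated by the corresponding
  \<open>g m\<close>. Hence the removed part has integral at most the sum of the
  \<open>c m\<close>.\<close>

lemma integral_thin_set_ge: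
  assumes f: "continuous_on UNIV f" and w: "\<And>m. m \<ge> 1 \<Longrightarrow> w m \<ge> 1"
    and c: "\<And>m. m \<ge> 1 \<Longrightarrow> (LINT t:circle|lebesgue. (cmod (dirichlet (w m) (real m * t)))\<^sup>2 * (cmod (f t))\<^sup>2)
        \<le> (real (w m))\<^sup>2 / 4 * c m"
    and X: "\<And>M. (\<Sum>m=1..M. c m) \<le> X"
  shows "(LINT t:circle|lebesgue. (cmod (f t))\<^sup>2) - X \<le> (LINT t:thin_set w|lebesgue. (cmod (f t))\<^sup>2)"
proof -
  let ?S = "thin_set w" and ?T = "circle - thin_set w"
  define g where "g m t = 4 / (real (w m))\<^sup>2 * ((cmod (dirichlet (w m) (real m * t)))\<^sup>2 * (cmod (f t))\<^sup>2)"
    for m t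
  have T: "?T \<in> sets lebesgue" using thin_set_measurable by auto
  have int: "set_integrable lebesgue A (\<lambda>t. (cmod (f t))\<^sup>2)" if "A \<in> sets lebesgue" "A \<subseteq> circle" for A
    by (intro set_integrable_circle continuous_intros that f)
  have intg: "set_integrable lebesgue circle (g m)" for m
    unfolding g_def by (intro set_integrable_circle continuous_intros f) auto
  have g0: "g m t \<ge> 0" for m t by (simp add: g_def)
  have gc: "(LINT t:circle|lebesgue. g m t) \<le> c m" if "m \<ge> 1" for m
    using c[OF that] w[OF that] unfolding g_def set_integral_mult_right by (simp add: field_simps)
  have X0: "X \<ge> 0" using X[of 0] by simp
  \<comment> \<open>Nonnegative integrals allow the series over \<open>m\<close> to be integrated
    termwise without a convergence argument; \<open>Suc\<close> starts the series at m = 1.\<close>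
  have "ennreal (LINT t:?T|lebesgue. (cmod (f t))\<^sup>2) =
      (\<integral>\<^sup>+t. ennreal (indicator ?T t * (cmod (f t))\<^sup>2) \<partial>lebesgue)"
    unfolding set_lebesgue_integral_def using int[OF T]
    by (subst nn_integral_eq_integral[symmetric]) (auto simp: set_integrable_def)
  also have "\<dots> \<le> (\<integral>\<^sup>+t. (\<Sum>m. ennreal (indicator circle t * g (Suc m) t)) \<partial>lebesgue)"
  proof (rule nn_integral_mono)
    fix t
    show "ennreal (indicator ?T t * (cmod (f t))\<^sup>2) \<le> (\<Sum>m. ennreal (indicator circle t * g (Suc m) t))"
    proof (cases "t \<in> ?T")
      case True
      then obtain m where m: "m \<ge> 1" "real (w m) < 2 * cmod (dirichlet (w m) (real m * t))"
        by (auto simp: thin_set_def not_le)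
      then have "(real (w m))\<^sup>2 \<le> (2 * cmod (dirichlet (w m) (real m * t)))\<^sup>2"
        by (intro power_mono) auto
      then have "1 \<le> 4 / (real (w m))\<^sup>2 * (cmod (dirichlet (w m) (real m * t)))\<^sup>2"
        using w[OF m(1)] by (simp add: field_simps)
      then have "1 * (cmod (f t))\<^sup>2 \<le> 4 / (real (w m))\<^sup>2 * (cmod (dirichlet (w m) (real m * t)))\<^sup>2 * (cmod (f t))\<^sup>2"
        by (rule mult_right_mono) simp
      then have "(cmod (f t))\<^sup>2 \<le> g m t" by (simp add: g_def mult.assoc)
      then have "ennreal (indicator ?T t * (cmod (f t))\<^sup>2) \<le> ennreal (indicator circle t * g (Suc (m - 1)) t)"
        using True m(1) by (intro ennreal_leI) simp
      also have "\<dots> \<le> (\<Sum>m. ennreal (indicator circle t * g (Suc m) t))"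
        using sum_le_suminf[of "\<lambda>m. ennreal (indicator circle t * g (Suc m) t)" "{m - 1}"]
        by (simp add: summableI)
      finally show ?thesis .
    qed simp
  qed
  also have "\<dots> = (\<Sum>m. \<integral>\<^sup>+t. ennreal (indicator circle t * g (Suc m) t) \<partial>lebesgue)"
    using borel_measurable_integrable[OF intg[unfolded set_integrable_def]]
    by (intro nn_integral_suminf) simp
  also have "\<dots> = (\<Sum>m. ennreal (LINT t:circle|lebesgue. g (Suc m) t))"
    unfolding set_lebesgue_integral_def
    by (subst nn_integral_eq_integral) (use intg g0 in \<open>auto simp: set_integrable_def\<close>)
  also have "\<dots> \<le> ennreal X"
  proof (rule suminf_le_const)
    fix M
    have "(\<Sum>m<M. ennreal (LINT t:circle|lebesgue. g (Suc m) t)) \<le> (\<Sum>m<M. ennreal (c (Suc m)))"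
      by (intro sum_mono ennreal_leI gc) simp
    also have "\<dots> = ennreal (\<Sum>m<M. c (Suc m))"
    proof (rule sum_ennreal)
      fix m
      have "0 \<le> (LINT t:circle|lebesgue. g (Suc m) t)"
        unfolding set_lebesgue_integral_def using g0 by (intro integral_nonneg_AE) auto
      then show "0 \<le> c (Suc m)" using gc[of "Suc m"] by simp
    qed
    also have "(\<Sum>m<M. c (Suc m)) = (\<Sum>m=1..M. c m)"
      by (simp add: sum.atLeast1_atMost_eq)
    finally show "(\<Sum>m<M. ennreal (LINT t:circle|lebesgue. g (Suc m) t)) \<le> ennreal X"
      using X[of M] by (meson ennreal_leI order_trans)
  qed (rule summableI)
  finally have "(LINT t:?T|lebesgue. (cmod (f t))\<^sup>2) \<le> X"
    using X0 by (simp add: ennreal_le_iff)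
  moreover have "(LINT t:circle|lebesgue. (cmod (f t))\<^sup>2) =
      (LINT t:?S|lebesgue. (cmod (f t))\<^sup>2) + (LINT t:?T|lebesgue. (cmod (f t))\<^sup>2)"
  proof -
    have "circle = ?S \<union> ?T" using thin_set_subset by auto
    then show ?thesis
      using set_integral_Un[of ?S ?T lebesgue "\<lambda>t. (cmod (f t))\<^sup>2"] int[OF thin_set_measurable thin_set_subset]
        int[OF T] by auto
  qed
  ultimately show ?thesis by linarith
qed

section \<open>Weights\<close>

text \<open>Large enough to make the sum of 1 / (m \<open>log_weight m\<close>) converge, yet
  smaller than any positive power of m, so the exponent in the growth of \<open>weight\<close> is
  not affected.\<close>

definition log_weight :: "nat \<Rightarrow> real" where
  "log_weight m = (1 + ln (real m))\<^sup>2"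

lemma log_weight_ge_1: "m \<ge> 1 \<Longrightarrow> log_weight m \<ge> 1"
  by (simp add: log_weight_def)

lemma log_weight_mono: "1 \<le> m \<Longrightarrow> m \<le> n \<Longrightarrow> log_weight m \<le> log_weight n"
  by (auto simp: log_weight_def intro!: power_mono)

lemma summable_log_weight: "summable (\<lambda>m. 1 / (real m * log_weight m))"
proof -
  \<comment> \<open>Cauchy condensation turns the terms into 1 / (1 + k ln 2)^2, comparable with 1 /
    k^2.\<close>
  have "summable (\<lambda>k. 2 ^ k * (1 / (real (2 ^ k) * log_weight (2 ^ k))))"
  proof (rule summable_comparison_test_ev)
    show "summable (\<lambda>k. 4 * real k powr (- 2))"
      by (intro summable_mult) (simp add: summable_real_powr_iff)
    have "norm (2 ^ k * (1 / (real (2 ^ k) * log_weight (2 ^ k)))) \<le> 4 * real k powr (- 2)"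
      if "k > 0" for k
    proof -
      have "real k * (1 / 2) \<le> real k * ln 2"
        using ln2_ge_two_thirds by (intro mult_left_mono) auto
      then have "(real k / 2)\<^sup>2 \<le> (1 + real k * ln 2)\<^sup>2" by (intro power_mono) auto
      then have "1 / (1 + real k * ln 2)\<^sup>2 \<le> 1 / (real k / 2)\<^sup>2"
        using that by (intro divide_left_mono) (auto intro!: mult_pos_pos add_pos_nonneg)
      then show ?thesis
        using that by (simp add: log_weight_def ln_realpow powr_minus field_simps)
    qed
    then show "\<forall>\<^sub>F k in sequentially. norm (2 ^ k * (1 / (real (2 ^ k) * log_weight (2 ^ k))))
        \<le> 4 * real k powr (- 2)"
      using eventually_gt_at_top[of 0] by (rule eventually_mono[rotated])
  qed
  then show ?thesis
  proof (subst condensation_test)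
    fix m :: nat assume "0 < m"
    then show "1 / (real (Suc m) * log_weight (Suc m)) \<le> 1 / (real m * log_weight m)"
      using log_weight_ge_1[of m] log_weight_mono[of m "Suc m"]
      by (intro divide_left_mono mult_mono mult_pos_pos) auto
  qed (auto simp: log_weight_def)
qed

definition weight :: "real \<Rightarrow> real \<Rightarrow> nat \<Rightarrow> nat" where
  "weight K p m = nat \<lceil>K * real m powr p * log_weight m\<rceil>"

lemma weight_ge: "K * real m powr p * log_weight m \<le> real (weight K p m)"
  unfolding weight_def by linarith

lemma weight_le:
  assumes "K \<ge> 0"
  shows "real (weight K p m) \<le> K * real m powr p * log_weight m + 1"
proof -
  have "0 \<le> K * real m powr p * log_weight m"
    using assms by (simp add: log_weight_def)
  then show ?thesis unfolding weight_def by linarith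
qed

lemma inverse_weight_le:
  assumes "K > 0" "m \<ge> 1"
  shows "weight K p m \<ge> 1"
    and "1 / real (weight K p m) \<le> 1 / (K * real m powr p * log_weight m)"
proof -
  have pos: "0 < K * real m powr p * log_weight m"
    using assms log_weight_ge_1[of m] by (intro mult_pos_pos) auto
  then have "0 < real (weight K p m)" using weight_ge[of K m p] by linarith
  then show "weight K p m \<ge> 1" by simp
  show "1 / real (weight K p m) \<le> 1 / (K * real m powr p * log_weight m)"
    using pos weight_ge[of K m p] \<open>0 < real (weight K p m)\<close> by (intro divide_left_mono) auto
qed

text \<open>The three summands are tailored to \<open>l = O(N powr \<alpha>)\<close> with \<open>p = 1 / \<alpha>\<close>: for small \<open>m\<close> the
  variable \<open>k\<close> of \<open>m * k + l * j = f\<close> is counted modulo \<open>l\<close>, for large \<open>m\<close> the variable \<open>j\<close> modulo \<open>m\<close>,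
  and the trivial bound \<open>N\<close> suffices for multiples of \<open>l\<close>.\<close>

lemma reps_weight_bound:
  fixes l N :: nat and K p :: real
  assumes "prime l" "K > 0" "p \<ge> 1" "real N \<le> real l powr p" "m \<ge> 1"
  defines "u \<equiv> \<lambda>m. 1 / (real m * log_weight m)"
  defines "d \<equiv> (1 + 64 powr p) * u m / K + (if 64 * m \<le> l then 1 / real l else 0)
      + (if l dvd m then u (m div l) / K else 0)"
  shows "real (card (reps m l (weight K p m) N f)) \<le> real (weight K p m) * d"
proof -
  let ?w = "real (weight K p m)"
  have l: "l \<ge> 1" using assms(1) prime_ge_1_nat by blast
  have w0: "?w > 0" using inverse_weight_le(1)[of K m p] assms by simp
  have u0: "u k \<ge> 0" for k by (simp add: u_def log_weight_def)
  have inv: "1 / ?w \<le> u m / K"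
  proof -
    have "real m \<le> real m powr p"
      using powr_mono[of 1 p "real m"] assms by simp
    then have "1 / (K * real m powr p * log_weight m) \<le> 1 / (K * real m * log_weight m)"
      using assms log_weight_ge_1[of m]
      by (intro divide_left_mono mult_right_mono mult_left_mono) auto
    then show ?thesis using inverse_weight_le(2)[of K m p] assms by (simp add: u_def mult_ac)
  qed
  \<comment> \<open>Each case bounds the count by some \<open>R\<close> and then compares
    \<open>R / ?w\<close> with the summand of \<open>d\<close> made for it.\<close>
  have reduce: "real (card (reps m l (weight K p m) N f)) \<le> ?w * d" if "R / ?w \<le> d"
    "real (card (reps m l (weight K p m) N f)) \<le> R" for R
    using that w0 by (simp add: field_simps)
  consider (dvd) "l dvd m" | (small) "\<not> l dvd m" "64 * m \<le> l" | (large) "\<not> l dvd m" "l < 64 * m"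
    by linarith
  then show ?thesis
  proof cases
    case dvd
    then obtain q where q: "m = l * q" ..
    then have q1: "q \<ge> 1" using assms(5) by (cases q) auto
    have "real N / ?w = real N * (1 / ?w)" by simp
    also have "\<dots> \<le> real l powr p * (1 / (K * real m powr p * log_weight m))"
      using assms inverse_weight_le(2)[of K m p] by (intro mult_mono) auto
    also have "\<dots> = 1 / (K * real q powr p * log_weight m)"
      using l q1 by (simp add: q powr_mult)
    also have "\<dots> \<le> 1 / (K * real q * log_weight q)"
    proof (intro divide_left_mono mult_mono)
      show "real q \<le> real q powr p" using powr_mono[of 1 p "real q"] assms(3) q1 by simp
      show "log_weight q \<le> log_weight m" using q q1 l by (intro log_weight_mono) auto
      show "0 < K * real q powr p * log_weight m * (K * real q * log_weight q)"
        using assms log_weight_ge_1[of q] log_weight_ge_1[of m] q1 by (intro mult_pos_pos) auto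
    qed (use assms q1 log_weight_ge_1[of q] in auto)
    also have "\<dots> = u (m div l) / K" using q l by (simp add: u_def mult_ac)
    also have "\<dots> \<le> d"
    proof -
      have "0 \<le> (1 + 64 powr p) * u m / K" using u0[of m] assms(2) by simp
      moreover have "0 \<le> (if 64 * m \<le> l then 1 / real l else 0)" by simp
      ultimately show ?thesis using dvd unfolding d_def by simp
    qed
    finally show ?thesis
      by (rule reduce) (use card_reps_le_length assms(5) in auto)
  next
    case small
    then have "coprime m l" using assms(1) by (simp add: coprime_commute prime_imp_coprime)
    then have "card (reps m l (weight K p m) N f) \<le> weight K p m div l + 1"
      using l by (rule card_reps_le_left)
    moreover have "real (weight K p m div l) \<le> ?w / real l" by (rule of_nat_div_le_of_nat)
    ultimately have "real (card (reps m l (weight K p m) N f)) \<le> ?w / real l + 1" by linarith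
    moreover have "(?w / real l + 1) / ?w \<le> d"
    proof -
      have "(?w / real l + 1) / ?w = 1 / real l + 1 / ?w" using w0 by (simp add: field_simps)
      also have "\<dots> \<le> 1 / real l + (1 + 64 powr p) * u m / K"
      proof -
        have "u m / K \<le> (1 + 64 powr p) * u m / K"
          using u0[of m] assms(2) by (intro divide_right_mono) (auto simp: mult_le_cancel_right1)
        then show ?thesis using inv by simp
      qed
      also have "\<dots> = d" using small by (simp add: d_def)
      finally show ?thesis .
    qed
    ultimately show ?thesis by (rule reduce[rotated])
  next
    case large
    then have "coprime m l" using assms(1) by (simp add: coprime_commute prime_imp_coprime)
    then have "card (reps m l (weight K p m) N f) \<le> N div m + 1"
      using assms(5) by (rule card_reps_le_right)
    moreover have "real (N div m) \<le> real N / real m" by (rule of_nat_div_le_of_nat)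
    ultimately have "real (card (reps m l (weight K p m) N f)) \<le> real N / real m + 1" by linarith
    moreover have "(real N / real m + 1) / ?w \<le> d"
    proof -
      \<comment> \<open>In this range \<open>l < 64 * m\<close>, so \<open>N\<close> is at most a
        constant times \<open>m powr p\<close>, which the weight absorbs.\<close>
      have "real N \<le> (64 * real m) powr p"
        using large by (intro order_trans[OF assms(4)] powr_mono2) (use assms(3) in auto)
      then have "real N / real m * (1 / ?w) \<le>
          (64 * real m) powr p / real m * (1 / (K * real m powr p * log_weight m))"
        using inverse_weight_le(2)[of K m p] assms by (intro mult_mono divide_right_mono) auto
      also have "\<dots> = 64 powr p * u m / K"
        using assms(5) by (simp add: powr_mult u_def)
      finally have "real N / real m * (1 / ?w) \<le> 64 powr p * u m / K" .
      then have "(real N / real m + 1) / ?w \<le> 64 powr p * u m / K + u m / K"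
        using inv by (simp add: add_divide_distrib)
      also have "\<dots> = d" using large by (simp add: d_def ring_distribs add_divide_distrib)
      finally show ?thesis .
    qed
    ultimately show ?thesis by (rule reduce[rotated])
  qed
qed

text \<open>At most l / 64 values of \<open>m\<close> contribute 1 / l each, which gives 1 / 64. The
  other two sums are multiples of \<open>W / K\<close>, and \<open>K\<close> is large enough to
  bound them together by another 1 / 64.\<close>

lemma sum_reps_weight_bound:
  fixes l M :: nat and K p W :: real and u :: "nat \<Rightarrow> real"
  assumes "l \<ge> 1" "K > 0" and u: "\<And>k. u k \<ge> 0" "\<And>M. (\<Sum>m=1..M. u m) \<le> W"
    and K: "64 * ((2 + 64 powr p) * W) \<le> K"
  shows "(\<Sum>m=1..M. (1 + 64 powr p) * u m / K + (if 64 * m \<le> l then 1 / real l else 0)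
      + (if l dvd m then u (m div l) / K else 0)) \<le> 1 / 32"
proof -
  have "(\<Sum>m=1..M. (1 + 64 powr p) * u m / K) = (1 + 64 powr p) / K * (\<Sum>m=1..M. u m)"
    by (simp add: sum_distrib_left)
  also have "\<dots> \<le> (1 + 64 powr p) / K * W"
    using assms by (intro mult_left_mono u) auto
  finally have 1: "(\<Sum>m=1..M. (1 + 64 powr p) * u m / K) \<le> (1 + 64 powr p) / K * W" .
  have "(\<Sum>m=1..M. if 64 * m \<le> l then 1 / real l else 0) = (\<Sum>m\<in>{m\<in>{1..M}. 64 * m \<le> l}. 1 / real l)"
    by (rule sum.inter_filter[symmetric]) simp
  also have "\<dots> = real (card {m\<in>{1..M}. 64 * m \<le> l}) / real l" by simp
  also have "\<dots> \<le> (real l / 64) / real l"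
  proof (intro divide_right_mono)
    have "card {m\<in>{1..M}. 64 * m \<le> l} \<le> card {1..l div 64}" by (intro card_mono) auto
    then show "real (card {m\<in>{1..M}. 64 * m \<le> l}) \<le> real l / 64" by simp
  qed simp
  also have "\<dots> = 1 / 64" using assms by simp
  finally have 2: "(\<Sum>m=1..M. if 64 * m \<le> l then 1 / real l else 0) \<le> 1 / 64" .
  have "(\<Sum>m=1..M. if l dvd m then u (m div l) / K else 0) = (\<Sum>m\<in>{m\<in>{1..M}. l dvd m}. u (m div l) / K)"
    by (rule sum.inter_filter[symmetric]) simp
  \<comment> \<open>Writing m = l q turns the sum over multiples of \<open>l\<close> into a sum of
    \<open>u q\<close>, again bounded by \<open>W\<close>.\<close>
  also have "\<dots> \<le> (\<Sum>m\<in>(*) l ` {1..M}. u (m div l) / K)"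
  proof (intro sum_mono2)
    show "{m\<in>{1..M}. l dvd m} \<subseteq> (*) l ` {1..M}"
    proof
      fix m assume "m \<in> {m\<in>{1..M}. l dvd m}"
      then obtain q where q: "m = l * q" "1 \<le> l * q" "l * q \<le> M" by auto
      then have "q \<ge> 1" by (cases q) auto
      moreover have "q \<le> l * q" using assms(1) by simp
      then have "q \<le> M" using q(3) by linarith
      ultimately show "m \<in> (*) l ` {1..M}" using q by (intro image_eqI[of _ _ q]) auto
    qed
  qed (use u assms in auto)
  also have "\<dots> = (\<Sum>q=1..M. u q / K)"
    by (subst sum.reindex) (use assms in \<open>auto simp: inj_on_def\<close>)
  also have "\<dots> = (\<Sum>q=1..M. u q) / K" by (rule sum_divide_distrib[symmetric])
  also have "\<dots> \<le> W / K" using u assms by (intro divide_right_mono) auto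
  finally have 3: "(\<Sum>m=1..M. if l dvd m then u (m div l) / K else 0) \<le> W / K" .
  have "(1 + 64 powr p) / K * W + W / K = ((2 + 64 powr p) * W) / K"
    unfolding times_divide_eq_left add_divide_distrib[symmetric] by (simp add: algebra_simps)
  also have "\<dots> \<le> 1 / 64" using K assms(2) by (simp add: field_simps)
  finally show ?thesis using 1 2 3 unfolding sum.distrib by linarith
qed

lemma riesz_lower_thin_set_progression:
  fixes l N :: nat
  assumes l: "prime l" and N: "real N \<le> real l powr p" and p: "p \<ge> 1" and "K > 0"
    and W: "\<And>M. (\<Sum>m=1..M. 1 / (real m * log_weight m)) \<le> W"
    and K: "64 * ((2 + 64 powr p) * W) \<le> K"
  shows "riesz_lower (thin_set (weight K p)) pi ((\<lambda>j. int (j * l)) ` {1..N})"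
  unfolding riesz_lower_def
proof
  fix a :: "int \<Rightarrow> complex"
  let ?B = "(\<lambda>j. int (j * l)) ` {1..N}" and ?w = "\<lambda>m. real (weight K p m)"
  define u where "u m = 1 / (real m * log_weight m)" for m
  define s where "s = (\<Sum>h\<in>?B. (cmod (a h))\<^sup>2)"
  define d where "d m = (1 + 64 powr p) * u m / K + (if 64 * m \<le> l then 1 / real l else 0)
      + (if l dvd m then u (m div l) / K else 0)" for m
  have l1: "l \<ge> 1" using l prime_ge_1_nat by blast
  then have inj: "inj_on (\<lambda>j. int (j * l)) {1..N}" by (auto simp: inj_on_def)
  have s: "s = (\<Sum>j=1..N. (cmod (a (int (j * l))))\<^sup>2)"
    unfolding s_def by (simp only: sum.reindex[OF inj] o_def)
  have trig: "trig_sum ?B a t = (\<Sum>j=1..N. a (int (j * l)) * cis (of_int (int (j * l)) * t))" for t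
    unfolding trig_sum_def by (simp only: sum.reindex[OF inj] o_def)
  have s0: "s \<ge> 0" by (simp add: s_def sum_nonneg)
  \<comment> \<open>The loss \<open>pi / 4 * s\<close> is 8 pi \<open>s\<close> times the total 1 /
    32; subtracted from the full norm 2 pi \<open>s\<close> it leaves more than pi
    \<open>s\<close>.\<close>
  have "(LINT t:circle|lebesgue. (cmod (trig_sum ?B a t))\<^sup>2) - pi / 4 * s
      \<le> (LINT t:thin_set (weight K p)|lebesgue. (cmod (trig_sum ?B a t))\<^sup>2)"
  proof (rule integral_thin_set_ge)
    show "weight K p m \<ge> 1" if "m \<ge> 1" for m
      using inverse_weight_le(1) \<open>K > 0\<close> that by blast
    show "(LINT t:circle|lebesgue. (cmod (dirichlet (weight K p m) (real m * t)))\<^sup>2 *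
        (cmod (trig_sum ?B a t))\<^sup>2) \<le> (?w m)\<^sup>2 / 4 * (8 * pi * s * d m)" if "m \<ge> 1" for m
    proof -
      have "(LINT t:circle|lebesgue. (cmod (dirichlet (weight K p m) (real m * t)))\<^sup>2 *
          (cmod (trig_sum ?B a t))\<^sup>2) \<le> 2 * pi * ((?w m * d m) * (?w m * s))"
        unfolding trig s
        unfolding d_def u_def
        by (intro integral_dirichlet_mult_le reps_weight_bound[OF l \<open>K > 0\<close> p N that])
      then show ?thesis by (simp add: power2_eq_square mult_ac)
    qed
    show "(\<Sum>m=1..M. 8 * pi * s * d m) \<le> pi / 4 * s" for M
    proof -
      have "(\<Sum>m=1..M. d m) \<le> 1 / 32"
        unfolding d_def
        by (rule sum_reps_weight_bound[where W = W]) (use l1 \<open>K > 0\<close> W K in \<open>auto simp: u_def log_weight_def\<close>)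
      then have "8 * pi * s * (\<Sum>m=1..M. d m) \<le> 8 * pi * s * (1 / 32)"
        using s0 by (intro mult_left_mono) auto
      then show ?thesis by (simp add: sum_distrib_left)
    qed
  qed (rule continuous_on_trig_sum)
  then have "2 * pi * s - pi / 4 * s \<le> (LINT t:thin_set (weight K p)|lebesgue. (cmod (trig_sum ?B a t))\<^sup>2)"
    by (simp add: parseval_trig_sum s_def)
  moreover have "0 \<le> pi * s" using s0 by simp
  ultimately show "pi * s \<le> (LINT t:thin_set (weight K p)|lebesgue. (cmod (trig_sum ?B a t))\<^sup>2)"
    by linarith
qed

section \<open>Progressions in frequency sets of thin sets\<close>

lemma thin_set_in_class_A:
  assumes \<alpha>: "0 < \<alpha>" "\<alpha> \<le> 1" and "K > 0"
    and W: "\<And>M. (\<Sum>m=1..M. 1 / (real m * log_weight m)) \<le> W"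
    and K: "64 * ((2 + 64 powr (1 / \<alpha>)) * W) \<le> K"
  shows "thin_set (weight K (1 / \<alpha>)) \<in> class_A \<alpha>"
proof -
  let ?S = "thin_set (weight K (1 / \<alpha>))"
  note S = thin_set_measurable[of "weight K (1 / \<alpha>)"] thin_set_subset[of "weight K (1 / \<alpha>)"]
  \<comment> \<open>Prime steps ensure that every \<open>m\<close> is either a multiple of the step
    or coprime to it.\<close>
  obtain l where l: "\<And>j::nat. prime (l j)" "\<And>j. l j > j" by (metis bigger_prime)
  define N where "N j = nat \<lfloor>real (l j) powr (1 / \<alpha>)\<rfloor>" for j
  define B where "B j = (\<lambda>k. int (k * l j)) ` {1..N j}" for j
  have p: "1 / \<alpha> \<ge> 1" using \<alpha> by simp
  have l1: "l j \<ge> 1" for j using l(1) prime_ge_1_nat by blast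
  have N_le: "real (N j) \<le> real (l j) powr (1 / \<alpha>)" for j
    unfolding N_def by (simp add: of_nat_floor)
  have N_gt: "j < N j" for j
  proof -
    have "real (l j) \<le> real (l j) powr (1 / \<alpha>)"
      using powr_mono[OF p, of "real (l j)"] l1[of j] by simp
    then have "int (l j) \<le> \<lfloor>real (l j) powr (1 / \<alpha>)\<rfloor>" by (simp add: le_floor_iff)
    then have "l j \<le> N j" unfolding N_def by linarith
    then show ?thesis using l(2)[of j] by simp
  qed
  have lower: "riesz_lower ?S pi (B j)" for j
    unfolding B_def using l(1) N_le p \<open>K > 0\<close> W K by (rule riesz_lower_thin_set_progression)
  have fin: "finite (B j)" for j by (simp add: B_def)
  \<comment> \<open>Positivity comes from the lower Riesz bound for a single exponential: its
    modulus is 1, so the measure is at least pi.\<close>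
  have "measure lebesgue ?S > 0"
  proof -
    have "int (l 0) \<in> B 0" using N_gt[of 0] by (auto simp: B_def intro!: image_eqI[of _ _ 1])
    then have "riesz_lower ?S pi {int (l 0)}"
      by (intro riesz_lower_antimono[OF lower[of 0]]) (auto simp: B_def)
    then have "pi * (\<Sum>h\<in>{int (l 0)}. (cmod 1)\<^sup>2) \<le>
        (LINT t:?S|lebesgue. (cmod (trig_sum {int (l 0)} (\<lambda>_. 1) t))\<^sup>2)"
      unfolding riesz_lower_def by (rule spec)
    also have "\<dots> = measure lebesgue ?S"
      by (simp add: trig_sum_def norm_mult set_lebesgue_integral_def S)
    finally show ?thesis by (simp add: less_le_trans[OF pi_gt_zero])
  qed
  moreover obtain Lam where Lam: "riesz_sequence Lam ?S \<and> (\<forall>j. \<exists>M. (+) M ` B j \<subseteq> Lam)"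
    using riesz_sequence_of_blocks[OF S pi_gt_zero fin lower] by (rule exE)
  moreover have "long_progressions \<alpha> Lam"
    unfolding long_progressions_def
  proof (intro exI[of _ 2] conjI)
    let ?A = "{N :: nat. \<exists>(M :: int) (l :: nat). l \<ge> 1 \<and> real l \<le> 2 * real N powr \<alpha> \<and>
        (\<lambda>k :: nat. M + int (k * l)) ` {1..N} \<subseteq> Lam}"
    have "N j \<in> ?A" for j
    proof -
      obtain M where "(+) M ` B j \<subseteq> Lam" using Lam by blast
      then have "(\<lambda>k. M + int (k * l j)) ` {1..N j} \<subseteq> Lam" by (auto simp: B_def)
      \<comment> \<open>Rounding down loses at most 1, hence at most a factor 2 in the length, and
        \<open>2 powr \<alpha>\<close> is at most 2.\<close>
      moreover have "real (l j) \<le> 2 * real (N j) powr \<alpha>"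
      proof -
        have "real (l j) powr (1 / \<alpha>) \<le> real (N j) + 1" unfolding N_def by linarith
        also have "\<dots> \<le> 2 * real (N j)" using N_gt[of j] by simp
        finally have "(real (l j) powr (1 / \<alpha>)) powr \<alpha> \<le> (2 * real (N j)) powr \<alpha>"
          using \<alpha> by (intro powr_mono2) auto
        then have "real (l j) \<le> 2 powr \<alpha> * real (N j) powr \<alpha>"
          using \<alpha> by (simp add: powr_powr powr_mult)
        also have "\<dots> \<le> 2 * real (N j) powr \<alpha>"
          using powr_mono[of \<alpha> 1 "2::real"] \<alpha> by (intro mult_right_mono) auto
        finally show ?thesis .
      qed
      ultimately show ?thesis using l1[of j] by blast
    qed
    then show "infinite ?A"
      unfolding infinite_nat_iff_unbounded using N_gt by blast
  qed simp
  ultimately show ?thesis unfolding class_A_def using S by blast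
qed

section \<open>Exclusion of progressions with smaller steps\<close>

lemma thin_set_growth_limit:
  fixes K C p \<gamma> :: real
  assumes "\<gamma> * p < 1" "\<gamma> > 0" "p > 0" "C > 0" "K > 0"
  shows "(\<lambda>n::nat. (K * (C * real n powr \<gamma>) powr p * (1 + ln (C * real n powr \<gamma>))\<^sup>2 + 1) / real n)
    \<longlonglongrightarrow> 0"
proof -
  \<comment> \<open>The power and the logarithm are expanded for the asymptotic computation; the two
    forms agree for n > 0.\<close>
  have "(\<lambda>n::nat. (K * (C powr p * real n powr (\<gamma> * p)) * (1 + (ln C + \<gamma> * ln (real n)))\<^sup>2 + 1) / real n)
      \<longlonglongrightarrow> 0"
    using assms by real_asymp
  then show ?thesis
  proof (rule Lim_transform_eventually)
    show "\<forall>\<^sub>F n in sequentially.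
        (K * (C powr p * real n powr (\<gamma> * p)) * (1 + (ln C + \<gamma> * ln (real n)))\<^sup>2 + 1) / real n =
        (K * (C * real n powr \<gamma>) powr p * (1 + ln (C * real n powr \<gamma>))\<^sup>2 + 1) / real n"
      using eventually_gt_at_top[of 0]
    proof eventually_elim
      case (elim n)
      have "ln (C * real n powr \<gamma>) = ln C + \<gamma> * ln (real n)"
        using assms elim by (subst ln_mult) (auto simp: ln_powr)
      then show ?case using assms by (simp add: powr_mult powr_powr)
    qed
  qed
qed

lemma thin_set_notin_class_A:
  assumes \<alpha>: "0 < \<alpha>" and \<beta>: "0 \<le> \<beta>" "\<beta> < \<alpha>" and "K > 0"
  shows "thin_set (weight K (1 / \<alpha>)) \<notin> class_A \<beta>"
proof
  let ?w = "weight K (1 / \<alpha>)"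
  let ?S = "thin_set ?w"
  assume "?S \<in> class_A \<beta>"
  then obtain Lam where "riesz_sequence Lam ?S" and prog: "long_progressions \<beta> Lam"
    unfolding class_A_def by blast
  then obtain A where A: "A > 0" and "\<And>F a. finite F \<Longrightarrow> F \<subseteq> Lam \<Longrightarrow>
      A * (\<Sum>l\<in>F. (cmod (a l))\<^sup>2) \<le> (LINT t:?S|lebesgue. (cmod (trig_sum F a t))\<^sup>2)"
    unfolding riesz_sequence_def L2_norm_on_trig_sum by blast
  then have lower: "riesz_lower ?S A F" if "finite F" "F \<subseteq> Lam" for F
    using that by (simp add: riesz_lower_def)
  obtain C0 where "C0 > 0" and inf: "infinite {N :: nat. \<exists>(M :: int) (l :: nat). l \<ge> 1 \<and>
      real l \<le> C0 * real N powr \<beta> \<and> (\<lambda>k :: nat. M + int (k * l)) ` {1..N} \<subseteq> Lam}"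
    using prog unfolding long_progressions_def by blast
  define C where "C = max C0 1"
  \<comment> \<open>The midpoint is positive even for \<beta> = 0 and still has \<gamma> / \<alpha>
    < 1, so \<open>g n\<close>, which bounds the weight of the step, is o(n).\<close>
  define \<gamma> where "\<gamma> = (\<alpha> + \<beta>) / 2"
  define g where "g n = K * (C * real n powr \<gamma>) powr (1 / \<alpha>) * (1 + ln (C * real n powr \<gamma>))\<^sup>2 + 1" for n :: nat
  have C: "C \<ge> 1" "C \<ge> C0" by (auto simp: C_def)
  have \<gamma>: "\<gamma> > 0" "\<beta> \<le> \<gamma>" "\<gamma> * (1 / \<alpha>) < 1" using \<alpha> \<beta> by (auto simp: \<gamma>_def)
  have "(\<lambda>n. g n / real n) \<longlonglongrightarrow> 0"
    unfolding g_def using \<gamma> \<alpha> C \<open>K > 0\<close> by (intro thin_set_growth_limit) auto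
  \<comment> \<open>The factor 576 is 64 * 9: the 64 comes from the test polynomial, the 9 from n <=
    3 N.\<close>
  then have "(\<lambda>n. 576 * pi * (g n / real n)\<^sup>2) \<longlonglongrightarrow> 576 * pi * 0\<^sup>2"
    by (intro tendsto_intros)
  then have "\<forall>\<^sub>F n in sequentially. 576 * pi * (g n / real n)\<^sup>2 < A"
    using A by (intro order_tendstoD(2)) auto
  then obtain n0 where n0: "\<And>n. n \<ge> n0 \<Longrightarrow> 576 * pi * (g n / real n)\<^sup>2 < A"
    unfolding eventually_sequentially by blast
  obtain n M l where n: "n > max n0 2" and l: "l \<ge> 1" "real l \<le> C0 * real n powr \<beta>"
    and sub: "(\<lambda>k :: nat. M + int (k * l)) ` {1..n} \<subseteq> Lam"
    using inf unfolding infinite_nat_iff_unbounded by blast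
  \<comment> \<open>A progression of length \<open>n\<close> covers the indices below 2 N, and n > 2
    gives n <= 2 N + 1 <= 3 N.\<close>
  define N where "N = n div 2"
  have N: "N \<ge> 1" "2 * N \<le> n" "n \<le> 3 * N" using n by (auto simp: N_def)
  have lx: "real l \<le> C * real n powr \<gamma>"
    using C \<gamma> n by (intro order_trans[OF l(2)] mult_mono powr_mono) auto
  have "A * (real N)\<^sup>2 \<le> 64 * pi * (real (?w l))\<^sup>2"
  proof (rule riesz_lower_thin_set_bound[where w = ?w and M = M])
    show "riesz_lower (thin_set ?w) A ((\<lambda>k. M + int (k * l)) ` {1..n})"
      by (rule lower) (use sub in auto)
    show "1 \<le> ?w l" using inverse_weight_le(1) \<open>K > 0\<close> l by blast
    show "M + int (k * l) \<in> (\<lambda>k. M + int (k * l)) ` {1..n}" if "k \<in> {1..<2 * N}" for k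
      using that N by (intro image_eqI[of _ _ k]) auto
  qed (use A l N in auto)
  also have "\<dots> \<le> 64 * pi * (g n)\<^sup>2"
  proof (intro mult_left_mono power_mono)
    have "real (?w l) \<le> K * real l powr (1 / \<alpha>) * log_weight l + 1"
      using \<open>K > 0\<close> by (intro weight_le) simp
    also have "\<dots> \<le> g n"
      unfolding g_def log_weight_def using l \<open>K > 0\<close> \<alpha> lx
      by (intro add_right_mono mult_mono mult_left_mono powr_mono2 power_mono add_left_mono) auto
    finally show "real (?w l) \<le> g n" .
  qed auto
  finally have "A * (real N)\<^sup>2 \<le> 64 * pi * (g n)\<^sup>2" .
  moreover have "A * (real n)\<^sup>2 \<le> A * (3 * real N)\<^sup>2"
    using A N by (intro mult_left_mono power_mono) auto
  ultimately have "A * (real n)\<^sup>2 \<le> 576 * pi * (g n)\<^sup>2"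
    by (simp add: power_mult_distrib)
  moreover have "576 * pi * (g n)\<^sup>2 < A * (real n)\<^sup>2"
    using n0[of n] n by (simp add: power_divide field_simps)
  ultimately show False by simp
qed

theorem theorem3:
  fixes \<alpha> :: real
  assumes "0 < \<alpha>" and "\<alpha> \<le> 1"
  shows "class_A \<alpha> - (\<Union>\<beta>\<in>{0..<\<alpha>}. class_A \<beta>) \<noteq> {}"
proof -
  define u where "u m = 1 / (real m * log_weight m)" for m
  define W where "W = suminf u"
  \<comment> \<open>The \<open>+ 1\<close> makes \<open>K\<close> positive from
    \<open>W \<ge> 0\<close> alone.\<close>
  define K where "K = 64 * ((2 + 64 powr (1 / \<alpha>)) * W) + 1"
  have u: "summable u" "\<And>m. u m \<ge> 0"
    using summable_log_weight by (auto simp: u_def[abs_def] log_weight_def)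
  have W: "(\<Sum>m=1..M. u m) \<le> W" for M
    unfolding W_def using u by (intro sum_le_suminf) auto
  have "W \<ge> 0" using W[of 0] by simp
  then have "K > 0" by (simp add: K_def add_nonneg_pos)
  have "thin_set (weight K (1 / \<alpha>)) \<in> class_A \<alpha>"
    using assms \<open>K > 0\<close> W[unfolded u_def] by (rule thin_set_in_class_A) (simp add: K_def)
  moreover have "thin_set (weight K (1 / \<alpha>)) \<notin> class_A \<beta>" if "\<beta> \<in> {0..<\<alpha>}" for \<beta>
    using that assms(1) \<open>K > 0\<close> by (intro thin_set_notin_class_A) auto
  ultimately show ?thesis by blast
qed

end
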